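(* Let $R$ be a commutative unital ring and let $\underline{C}$ be an $R$-linear triangulated category. For any maximal ideal $p$ of $R$ let $R_p$ be the localization of $R$ at $p$, let $\underline{C}_p$ be the triangulated category whose objects are those of $\underline{C}$ and whose morphisms are given by $\underline{C}_p(X,Y)=\underline{C}(X,Y)\otimes_R R_p$, and let $L_p:\underline{C}\to\underline{C}_p$ be the obvious functor (identity on objects, $f\mapsto f\otimes 1$ on morphisms). Let $D\subset\operatorname{Obj}\underline{C}$ and $Y\in\operatorname{Obj}\underline{C}$. Then $Y$ belongs to the envelope of $D$ in $\underline{C}$ if and only if $L_p(Y)$ belongs to the envelope of $L_p(D)$ in $\underline{C}_p$ for every maximal ideal $p$ of $R$.
   Context: The category $\underline{C}$ is not assumed to be small. For $A,B,C\in\operatorname{Obj}\underline{C}$, $C$ is an extension of $B$ by $A$ if there is a distinguished triangle $A\to C\to B\to A[1]$. A class of objects is extension-closed if it contains $0$ and is closed with respect to extensions. An object $X$ is a retract of $Y$ if $\operatorname{id}_X$ factors through $Y$; a class of objects is Karoubi-closed if it contains all retracts of its elements. The envelope of a class $D$ of objects of a triangulated category is the smallest extension-closed Karoubi-closed class of objects containing $D$. The triangulated structure on $\underline{C}_p$ is the one (known to exist) for which $L_p$ is isomorphic to the Verdier quotient functor for the localization of $\underline{C}$ by its triangulated subcategory generated by $\{\operatorname{Cone}(X\xrightarrow{s\operatorname{id}_X}X)\mid s\in R\setminus p,\ X\in\operatorname{Obj}\underline{C}\}$. *)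

theory Defs
  imports "HOL-Algebra.Module" "HOL-Algebra.Ideal" "HOL-Algebra.Free_Abelian_Groups"
begin

section \<open>Categories and functors\<close>

text \<open>
  The hom-sets of a category are not required to be disjoint, so composition takes the
  objects as arguments: \<open>Comp C X Y Z g f\<close> is the composite of
  \<open>f : X \<rightarrow> Y\<close> and \<open>g : Y \<rightarrow> Z\<close>. No smallness condition is imposed; objects and morphisms
  range over arbitrary types.
\<close>

record ('o, 'm) category =
  Obj :: "'o set"
  Hom :: "'o \<Rightarrow> 'o \<Rightarrow> 'm set"
  Ident :: "'o \<Rightarrow> 'm"
  Comp :: "'o \<Rightarrow> 'o \<Rightarrow> 'o \<Rightarrow> 'm \<Rightarrow> 'm \<Rightarrow> 'm"

locale is_category =
  fixes C :: "('o, 'm, 'x) category_scheme"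
  assumes Ident_closed: "X \<in> Obj C \<Longrightarrow> Ident C X \<in> Hom C X X"
    and Comp_closed: "\<lbrakk>X \<in> Obj C; Y \<in> Obj C; Z \<in> Obj C; f \<in> Hom C X Y; g \<in> Hom C Y Z\<rbrakk>
      \<Longrightarrow> Comp C X Y Z g f \<in> Hom C X Z"
    and Comp_Ident_right: "\<lbrakk>X \<in> Obj C; Y \<in> Obj C; f \<in> Hom C X Y\<rbrakk>
      \<Longrightarrow> Comp C X X Y f (Ident C X) = f"
    and Comp_Ident_left: "\<lbrakk>X \<in> Obj C; Y \<in> Obj C; f \<in> Hom C X Y\<rbrakk>
      \<Longrightarrow> Comp C X Y Y (Ident C Y) f = f"
    and Comp_assoc: "\<lbrakk>X \<in> Obj C; Y \<in> Obj C; Z \<in> Obj C; W \<in> Obj C;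
        f \<in> Hom C X Y; g \<in> Hom C Y Z; h \<in> Hom C Z W\<rbrakk>
      \<Longrightarrow> Comp C X Z W h (Comp C X Y Z g f) = Comp C X Y W (Comp C Y Z W h g) f"

definition iso_mor :: "('o, 'm, 'x) category_scheme \<Rightarrow> 'o \<Rightarrow> 'o \<Rightarrow> 'm \<Rightarrow> bool" where
  "iso_mor C X Y f \<longleftrightarrow> f \<in> Hom C X Y \<and>
     (\<exists>g\<in>Hom C Y X. Comp C X Y X g f = Ident C X \<and> Comp C Y X Y f g = Ident C Y)"

definition zero_object :: "('o, 'm, 'x) category_scheme \<Rightarrow> 'o \<Rightarrow> bool" where
  "zero_object C Z \<longleftrightarrow> Z \<in> Obj C \<and>
     (\<forall>X\<in>Obj C. (\<exists>!f. f \<in> Hom C X Z) \<and> (\<exists>!f. f \<in> Hom C Z X))"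

definition retract :: "('o, 'm, 'x) category_scheme \<Rightarrow> 'o \<Rightarrow> 'o \<Rightarrow> bool" where
  "retract C X Y \<longleftrightarrow> X \<in> Obj C \<and> Y \<in> Obj C \<and>
     (\<exists>i\<in>Hom C X Y. \<exists>r\<in>Hom C Y X. Comp C X Y X r i = Ident C X)"

record ('o, 'm, 'o2, 'm2) cat_map =
  on_obj :: "'o \<Rightarrow> 'o2"
  on_mor :: "'o \<Rightarrow> 'o \<Rightarrow> 'm \<Rightarrow> 'm2"

definition is_functor ::
  "('o, 'm, 'x) category_scheme \<Rightarrow> ('o2, 'm2, 'y) category_scheme \<Rightarrow>
   ('o, 'm, 'o2, 'm2) cat_map \<Rightarrow> bool" where
  "is_functor C C' F \<longleftrightarrow>
     (\<forall>X\<in>Obj C. on_obj F X \<in> Obj C' \<and> on_mor F X X (Ident C X) = Ident C' (on_obj F X)) \<and>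
     (\<forall>X\<in>Obj C. \<forall>Y\<in>Obj C. \<forall>f\<in>Hom C X Y. on_mor F X Y f \<in> Hom C' (on_obj F X) (on_obj F Y)) \<and>
     (\<forall>X\<in>Obj C. \<forall>Y\<in>Obj C. \<forall>Z\<in>Obj C. \<forall>f\<in>Hom C X Y. \<forall>g\<in>Hom C Y Z.
        on_mor F X Z (Comp C X Y Z g f) =
          Comp C' (on_obj F X) (on_obj F Y) (on_obj F Z) (on_mor F Y Z g) (on_mor F X Y f))"

definition fully_faithful ::
  "('o, 'm, 'x) category_scheme \<Rightarrow> ('o2, 'm2, 'y) category_scheme \<Rightarrow>
   ('o, 'm, 'o2, 'm2) cat_map \<Rightarrow> bool" where
  "fully_faithful C C' F \<longleftrightarrow>
     (\<forall>X\<in>Obj C. \<forall>Y\<in>Obj C. bij_betw (on_mor F X Y) (Hom C X Y) (Hom C' (on_obj F X) (on_obj F Y)))"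


section \<open>Linear categories\<close>

record ('o, 'm, 'r) linear_category = "('o, 'm) category" +
  Add :: "'o \<Rightarrow> 'o \<Rightarrow> 'm \<Rightarrow> 'm \<Rightarrow> 'm"
  Zero :: "'o \<Rightarrow> 'o \<Rightarrow> 'm"
  Scale :: "'o \<Rightarrow> 'o \<Rightarrow> 'r \<Rightarrow> 'm \<Rightarrow> 'm"

text \<open>
  Module records extend ring records; the locale \<open>module\<close> does not use their multiplicative part.
\<close>

definition hom_module ::
  "('o, 'm, 'r, 'x) linear_category_scheme \<Rightarrow> 'o \<Rightarrow> 'o \<Rightarrow> ('r, 'm) module" where
  "hom_module C X Y =
     \<lparr>carrier = Hom C X Y, monoid.mult = undefined, one = undefined,
      ring.zero = Zero C X Y, add = Add C X Y, smult = Scale C X Y\<rparr>"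

locale is_linear_category = is_category C
  for R :: "('r, 'y) ring_scheme"
    and C :: "('o, 'm, 'r, 'x) linear_category_scheme" +
  assumes cring_scalars: "cring R"
    and hom_module: "\<lbrakk>X \<in> Obj C; Y \<in> Obj C\<rbrakk> \<Longrightarrow> module R (hom_module C X Y)"
    and Comp_Add_right: "\<lbrakk>X \<in> Obj C; Y \<in> Obj C; Z \<in> Obj C;
        f \<in> Hom C X Y; f' \<in> Hom C X Y; g \<in> Hom C Y Z\<rbrakk>
      \<Longrightarrow> Comp C X Y Z g (Add C X Y f f') = Add C X Z (Comp C X Y Z g f) (Comp C X Y Z g f')"
    and Comp_Add_left: "\<lbrakk>X \<in> Obj C; Y \<in> Obj C; Z \<in> Obj C;
        f \<in> Hom C X Y; g \<in> Hom C Y Z; g' \<in> Hom C Y Z\<rbrakk>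
      \<Longrightarrow> Comp C X Y Z (Add C Y Z g g') f = Add C X Z (Comp C X Y Z g f) (Comp C X Y Z g' f)"
    and Comp_Scale_right: "\<lbrakk>X \<in> Obj C; Y \<in> Obj C; Z \<in> Obj C; r \<in> carrier R;
        f \<in> Hom C X Y; g \<in> Hom C Y Z\<rbrakk>
      \<Longrightarrow> Comp C X Y Z g (Scale C X Y r f) = Scale C X Z r (Comp C X Y Z g f)"
    and Comp_Scale_left: "\<lbrakk>X \<in> Obj C; Y \<in> Obj C; Z \<in> Obj C; r \<in> carrier R;
        f \<in> Hom C X Y; g \<in> Hom C Y Z\<rbrakk>
      \<Longrightarrow> Comp C X Y Z (Scale C Y Z r g) f = Scale C X Z r (Comp C X Y Z g f)"

definition biproduct ::
  "('o, 'm, 'r, 'x) linear_category_scheme \<Rightarrow> 'o \<Rightarrow> 'o \<Rightarrow> 'o \<Rightarrow> bool" where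
  "biproduct C X Y P \<longleftrightarrow> P \<in> Obj C \<and>
     (\<exists>i\<in>Hom C X P. \<exists>j\<in>Hom C Y P. \<exists>p\<in>Hom C P X. \<exists>q\<in>Hom C P Y.
        Comp C X P X p i = Ident C X \<and> Comp C Y P Y q j = Ident C Y \<and>
        Comp C Y P X p j = Zero C Y X \<and> Comp C X P Y q i = Zero C X Y \<and>
        Add C P P (Comp C P X P i p) (Comp C P Y P j q) = Ident C P)"

locale is_additive_linear_category = is_linear_category +
  assumes ex_zero_object: "\<exists>Z. zero_object C Z"
    and ex_biproduct: "\<lbrakk>X \<in> Obj C; Y \<in> Obj C\<rbrakk> \<Longrightarrow> \<exists>P. biproduct C X Y P"


section \<open>Triangulated categories\<close>

record ('o, 'm) suspension =
  sh :: "'o \<Rightarrow> 'o"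
  sh_mor :: "'o \<Rightarrow> 'o \<Rightarrow> 'm \<Rightarrow> 'm"

text \<open>\<open>(X, Y, Z, f, g, h)\<close> stands for \<open>X \<rightarrow> Y \<rightarrow> Z \<rightarrow> X[1]\<close>.\<close>

type_synonym ('o, 'm) triangle = "'o \<times> 'o \<times> 'o \<times> 'm \<times> 'm \<times> 'm"

record ('o, 'm) triangulation = "('o, 'm) suspension" +
  triangles :: "('o, 'm) triangle set"

definition shift_map :: "('o, 'm, 'x) suspension_scheme \<Rightarrow> ('o, 'm, 'o, 'm) cat_map" where
  "shift_map T = \<lparr>on_obj = sh T, on_mor = sh_mor T\<rparr>"

fun is_triangle ::
  "('o, 'm, 'x) category_scheme \<Rightarrow> ('o, 'm, 'y) suspension_scheme \<Rightarrow> ('o, 'm) triangle \<Rightarrow> bool" where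
  "is_triangle C T (X, Y, Z, f, g, h) \<longleftrightarrow>
     X \<in> Obj C \<and> Y \<in> Obj C \<and> Z \<in> Obj C \<and>
     f \<in> Hom C X Y \<and> g \<in> Hom C Y Z \<and> h \<in> Hom C Z (sh T X)"

fun triangle_mor ::
  "('o, 'm, 'x) category_scheme \<Rightarrow> ('o, 'm, 'y) suspension_scheme \<Rightarrow>
   ('o, 'm) triangle \<Rightarrow> ('o, 'm) triangle \<Rightarrow> 'm \<times> 'm \<times> 'm \<Rightarrow> bool" where
  "triangle_mor C T (X, Y, Z, f, g, h) (X', Y', Z', f', g', h') (a, b, c) \<longleftrightarrow>
     a \<in> Hom C X X' \<and> b \<in> Hom C Y Y' \<and> c \<in> Hom C Z Z' \<and>
     Comp C X Y Y' b f = Comp C X X' Y' f' a \<and>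
     Comp C Y Z Z' c g = Comp C Y Y' Z' g' b \<and>
     Comp C Z (sh T X) (sh T X') (sh_mor T X X' a) h = Comp C Z Z' (sh T X') h' c"

fun triangle_iso ::
  "('o, 'm, 'x) category_scheme \<Rightarrow> ('o, 'm, 'y) suspension_scheme \<Rightarrow>
   ('o, 'm) triangle \<Rightarrow> ('o, 'm) triangle \<Rightarrow> bool" where
  "triangle_iso C T (X, Y, Z, f, g, h) (X', Y', Z', f', g', h') \<longleftrightarrow>
     (\<exists>a b c. triangle_mor C T (X, Y, Z, f, g, h) (X', Y', Z', f', g', h') (a, b, c) \<and>
        iso_mor C X X' a \<and> iso_mor C Y Y' b \<and> iso_mor C Z Z' c)"

text \<open>
  The shift is an \<open>R\<close>-linear self-equivalence (not necessarily an automorphism). The locale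
  assumptions \<open>TR1_iso\<close> to \<open>TR4\<close> are Verdier's axioms, \<open>TR4\<close> being the octahedral one.
\<close>

locale is_linear_triangulated_category = is_additive_linear_category R C
  for R :: "('r, 'y) ring_scheme"
    and C :: "('o, 'm, 'r, 'x) linear_category_scheme" +
  fixes T :: "('o, 'm, 'z) triangulation_scheme"
  assumes shift_functor: "is_functor C C (shift_map T)"
    and shift_fully_faithful: "fully_faithful C C (shift_map T)"
    and shift_ess_surj: "Y \<in> Obj C \<Longrightarrow> \<exists>X\<in>Obj C. \<exists>u. iso_mor C (sh T X) Y u"
    and shift_Add: "\<lbrakk>X \<in> Obj C; Y \<in> Obj C; f \<in> Hom C X Y; g \<in> Hom C X Y\<rbrakk>
      \<Longrightarrow> sh_mor T X Y (Add C X Y f g) = Add C (sh T X) (sh T Y) (sh_mor T X Y f) (sh_mor T X Y g)"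
    and shift_Scale: "\<lbrakk>X \<in> Obj C; Y \<in> Obj C; r \<in> carrier R; f \<in> Hom C X Y\<rbrakk>
      \<Longrightarrow> sh_mor T X Y (Scale C X Y r f) = Scale C (sh T X) (sh T Y) r (sh_mor T X Y f)"
    and triangles: "t \<in> triangles T \<Longrightarrow> is_triangle C T t"
    and TR1_iso: "\<lbrakk>t \<in> triangles T; is_triangle C T t'; triangle_iso C T t t'\<rbrakk>
      \<Longrightarrow> t' \<in> triangles T"
    and TR1_id: "\<lbrakk>X \<in> Obj C; zero_object C Z\<rbrakk>
      \<Longrightarrow> (X, X, Z, Ident C X, Zero C X Z, Zero C Z (sh T X)) \<in> triangles T"
    and TR1_cone: "\<lbrakk>X \<in> Obj C; Y \<in> Obj C; f \<in> Hom C X Y\<rbrakk>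
      \<Longrightarrow> \<exists>Z g h. (X, Y, Z, f, g, h) \<in> triangles T"
    and TR2: "is_triangle C T (X, Y, Z, f, g, h) \<Longrightarrow>
      (X, Y, Z, f, g, h) \<in> triangles T \<longleftrightarrow>
      (Y, Z, sh T X, g, h, \<ominus>\<^bsub>hom_module C (sh T X) (sh T Y)\<^esub> (sh_mor T X Y f)) \<in> triangles T"
    and TR3: "\<lbrakk>(X, Y, Z, f, g, h) \<in> triangles T; (X', Y', Z', f', g', h') \<in> triangles T;
        a \<in> Hom C X X'; b \<in> Hom C Y Y'; Comp C X Y Y' b f = Comp C X X' Y' f' a\<rbrakk>
      \<Longrightarrow> \<exists>c. triangle_mor C T (X, Y, Z, f, g, h) (X', Y', Z', f', g', h') (a, b, c)"
    and TR4: "\<lbrakk>X \<in> Obj C; Y \<in> Obj C; Z \<in> Obj C; f \<in> Hom C X Y; g \<in> Hom C Y Z;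
        (X, Y, Q1, f, p1, d1) \<in> triangles T;
        (X, Z, Q2, Comp C X Y Z g f, p2, d2) \<in> triangles T;
        (Y, Z, Q3, g, p3, d3) \<in> triangles T\<rbrakk>
      \<Longrightarrow> \<exists>a b.
        triangle_mor C T (X, Y, Q1, f, p1, d1) (X, Z, Q2, Comp C X Y Z g f, p2, d2)
          (Ident C X, g, a) \<and>
        triangle_mor C T (X, Z, Q2, Comp C X Y Z g f, p2, d2) (Y, Z, Q3, g, p3, d3)
          (f, Ident C Z, b) \<and>
        (Q1, Q2, Q3, a, b, Comp C Q3 (sh T Y) (sh T Q1) (sh_mor T Y Q1 p1) d3) \<in> triangles T"


section \<open>Envelopes\<close>

text \<open>
  A class that is closed under extensions is closed under isomorphism, so containing one zero object
  is the same as containing all of them.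
\<close>

definition extension_closed ::
  "('o, 'm, 'x) category_scheme \<Rightarrow> ('o, 'm, 'z) triangulation_scheme \<Rightarrow> 'o set \<Rightarrow> bool" where
  "extension_closed C T E \<longleftrightarrow>
     (\<forall>Z. zero_object C Z \<longrightarrow> Z \<in> E) \<and>
     (\<forall>A B X f g h. (A, X, B, f, g, h) \<in> triangles T \<and> A \<in> E \<and> B \<in> E \<longrightarrow> X \<in> E)"

definition Karoubi_closed :: "('o, 'm, 'x) category_scheme \<Rightarrow> 'o set \<Rightarrow> bool" where
  "Karoubi_closed C E \<longleftrightarrow> (\<forall>X Y. Y \<in> E \<and> retract C X Y \<longrightarrow> X \<in> E)"

definition envelope ::
  "('o, 'm, 'x) category_scheme \<Rightarrow> ('o, 'm, 'z) triangulation_scheme \<Rightarrow> 'o set \<Rightarrow> 'o set" where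
  "envelope C T D = \<Inter>{E. E \<subseteq> Obj C \<and> D \<subseteq> E \<and> extension_closed C T E \<and> Karoubi_closed C E}"


section \<open>Verdier quotients\<close>

text \<open>Strict full triangulated subcategories, given by their classes of objects.\<close>

definition triangulated_subcategory ::
  "('o, 'm, 'x) category_scheme \<Rightarrow> ('o, 'm, 'z) triangulation_scheme \<Rightarrow> 'o set \<Rightarrow> bool" where
  "triangulated_subcategory C T N \<longleftrightarrow>
     N \<subseteq> Obj C \<and>
     (\<forall>Z. zero_object C Z \<longrightarrow> Z \<in> N) \<and>
     (\<forall>X\<in>N. \<forall>Y\<in>Obj C. (\<exists>u. iso_mor C X Y u) \<longrightarrow> Y \<in> N) \<and>
     (\<forall>X\<in>Obj C. X \<in> N \<longleftrightarrow> sh T X \<in> N) \<and>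
     (\<forall>X Y Z f g h. (X, Y, Z, f, g, h) \<in> triangles T \<and> X \<in> N \<and> Y \<in> N \<longrightarrow> Z \<in> N)"

definition generated_subcategory ::
  "('o, 'm, 'x) category_scheme \<Rightarrow> ('o, 'm, 'z) triangulation_scheme \<Rightarrow> 'o set \<Rightarrow> 'o set" where
  "generated_subcategory C T S = \<Inter>{N. S \<subseteq> N \<and> triangulated_subcategory C T N}"

definition mor_with_cone_in ::
  "('o, 'm, 'x) category_scheme \<Rightarrow> ('o, 'm, 'z) triangulation_scheme \<Rightarrow> 'o set \<Rightarrow>
   'o \<Rightarrow> 'o \<Rightarrow> 'm set" where
  "mor_with_cone_in C T N X Y =
     {s \<in> Hom C X Y. \<exists>Z\<in>N. \<exists>g h. (X, Y, Z, s, g, h) \<in> triangles T}"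

text \<open>
  Morphisms \<open>X \<rightarrow> Y\<close> of the Verdier quotient by \<open>N\<close> are equivalence classes of roofs \<open>(Z, s, f)\<close>, which
  stand for \<open>X \<leftarrow> Z \<rightarrow> Y\<close> with \<open>s : Z \<rightarrow> X\<close> having its cone in \<open>N\<close>. Two roofs are equivalent if some
  roof dominates both. The composite of \<open>X \<leftarrow> Z \<rightarrow> Y\<close> and \<open>Y \<leftarrow> W \<rightarrow> V\<close> is obtained from any
  commutative square \<open>P \<rightarrow> Z \<rightarrow> Y\<close>, \<open>P \<rightarrow> W \<rightarrow> Y\<close> in which the cone of \<open>P \<rightarrow> Z\<close> lies in \<open>N\<close>. The
  result does not depend on the representatives or on the square; the unions below are
  therefore single equivalence classes.
\<close>

definition roofs ::
  "('o, 'm, 'x) category_scheme \<Rightarrow> ('o, 'm, 'z) triangulation_scheme \<Rightarrow> 'o set \<Rightarrow>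
   'o \<Rightarrow> 'o \<Rightarrow> ('o \<times> 'm \<times> 'm) set" where
  "roofs C T N X Y = {(Z, s, f). Z \<in> Obj C \<and> s \<in> mor_with_cone_in C T N Z X \<and> f \<in> Hom C Z Y}"

fun roof_equiv ::
  "('o, 'm, 'x) category_scheme \<Rightarrow> ('o, 'm, 'z) triangulation_scheme \<Rightarrow> 'o set \<Rightarrow>
   'o \<Rightarrow> 'o \<Rightarrow> 'o \<times> 'm \<times> 'm \<Rightarrow> 'o \<times> 'm \<times> 'm \<Rightarrow> bool" where
  "roof_equiv C T N X Y (Z, s, f) (Z', s', f') \<longleftrightarrow>
     (\<exists>W\<in>Obj C. \<exists>u\<in>Hom C W Z. \<exists>v\<in>Hom C W Z'.
        Comp C W Z X s u \<in> mor_with_cone_in C T N W X \<and>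
        Comp C W Z X s u = Comp C W Z' X s' v \<and>
        Comp C W Z Y f u = Comp C W Z' Y f' v)"

definition roof_class ::
  "('o, 'm, 'x) category_scheme \<Rightarrow> ('o, 'm, 'z) triangulation_scheme \<Rightarrow> 'o set \<Rightarrow>
   'o \<Rightarrow> 'o \<Rightarrow> 'o \<times> 'm \<times> 'm \<Rightarrow> ('o \<times> 'm \<times> 'm) set" where
  "roof_class C T N X Y \<rho> = {\<rho>' \<in> roofs C T N X Y. roof_equiv C T N X Y \<rho> \<rho>'}"

definition verdier_category ::
  "('o, 'm, 'x) category_scheme \<Rightarrow> ('o, 'm, 'z) triangulation_scheme \<Rightarrow> 'o set \<Rightarrow>
   ('o, ('o \<times> 'm \<times> 'm) set) category" where
  "verdier_category C T N =
     \<lparr>Obj = Obj C,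
      Hom = (\<lambda>X Y. roof_class C T N X Y ` roofs C T N X Y),
      Ident = (\<lambda>X. roof_class C T N X X (X, Ident C X, Ident C X)),
      Comp = (\<lambda>X Y V \<beta> \<alpha>. \<Union>{roof_class C T N X V (P, Comp C P Z X s u, Comp C P W V g v) |
          Z s f W t g P u v.
          (Z, s, f) \<in> \<alpha> \<and> (W, t, g) \<in> \<beta> \<and> P \<in> Obj C \<and>
          u \<in> mor_with_cone_in C T N P Z \<and> v \<in> Hom C P W \<and>
          Comp C P Z Y f u = Comp C P W Y t v})\<rparr>"

definition verdier_functor ::
  "('o, 'm, 'x) category_scheme \<Rightarrow> ('o, 'm, 'z) triangulation_scheme \<Rightarrow> 'o set \<Rightarrow>
   ('o, 'm, 'o, ('o \<times> 'm \<times> 'm) set) cat_map" where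
  "verdier_functor C T N =
     \<lparr>on_obj = (\<lambda>X. X), on_mor = (\<lambda>X Y f. roof_class C T N X Y (X, Ident C X, f))\<rparr>"

definition verdier_suspension ::
  "('o, 'm, 'x) category_scheme \<Rightarrow> ('o, 'm, 'z) triangulation_scheme \<Rightarrow> 'o set \<Rightarrow>
   ('o, ('o \<times> 'm \<times> 'm) set) suspension" where
  "verdier_suspension C T N =
     \<lparr>sh = sh T,
      sh_mor = (\<lambda>X Y \<alpha>. \<Union>(Z, s, f)\<in>\<alpha>.
         roof_class C T N (sh T X) (sh T Y) (sh T Z, sh_mor T Z X s, sh_mor T Z Y f))\<rparr>"

text \<open>The image of a triangle under a functor that commutes with the shifts.\<close>

fun map_triangle ::
  "('o, 'm, 'x) suspension_scheme \<Rightarrow> ('o, 'm, 'o2, 'm2) cat_map \<Rightarrow>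
   ('o, 'm) triangle \<Rightarrow> ('o2, 'm2) triangle" where
  "map_triangle T F (X, Y, Z, f, g, h) =
     (on_obj F X, on_obj F Y, on_obj F Z, on_mor F X Y f, on_mor F Y Z g, on_mor F Z (sh T X) h)"

definition verdier_triangulation ::
  "('o, 'm, 'x) category_scheme \<Rightarrow> ('o, 'm, 'z) triangulation_scheme \<Rightarrow> 'o set \<Rightarrow>
   ('o, ('o \<times> 'm \<times> 'm) set) triangulation" where
  "verdier_triangulation C T N =
     \<lparr>sh = sh (verdier_suspension C T N),
      sh_mor = sh_mor (verdier_suspension C T N),
      triangles = {t. is_triangle (verdier_category C T N) (verdier_suspension C T N) t \<and>
        (\<exists>t'\<in>triangles T. triangle_iso (verdier_category C T N) (verdier_suspension C T N)
           (map_triangle T (verdier_functor C T N) t') t)}\<rparr>"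

definition triangulated_isomorphism ::
  "('o, 'm, 'x) category_scheme \<Rightarrow> ('o, 'm, 'z) triangulation_scheme \<Rightarrow>
   ('o2, 'm2, 'x2) category_scheme \<Rightarrow> ('o2, 'm2, 'z2) triangulation_scheme \<Rightarrow>
   ('o, 'm, 'o2, 'm2) cat_map \<Rightarrow> bool" where
  "triangulated_isomorphism C T C' T' F \<longleftrightarrow>
     is_functor C C' F \<and> fully_faithful C C' F \<and> bij_betw (on_obj F) (Obj C) (Obj C') \<and>
     (\<forall>X\<in>Obj C. on_obj F (sh T X) = sh T' (on_obj F X)) \<and>
     (\<forall>X\<in>Obj C. \<forall>Y\<in>Obj C. \<forall>f\<in>Hom C X Y.
        on_mor F (sh T X) (sh T Y) (sh_mor T X Y f) =
          sh_mor T' (on_obj F X) (on_obj F Y) (on_mor F X Y f)) \<and>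
     (\<forall>t. is_triangle C T t \<longrightarrow> (t \<in> triangles T \<longleftrightarrow> map_triangle T F t \<in> triangles T'))"

definition isomorphic_to_verdier_functor ::
  "('o, 'm, 'x) category_scheme \<Rightarrow> ('o, 'm, 'z) triangulation_scheme \<Rightarrow> 'o set \<Rightarrow>
   ('o2, 'm2, 'x2) category_scheme \<Rightarrow> ('o2, 'm2, 'z2) triangulation_scheme \<Rightarrow>
   ('o, 'm, 'o2, 'm2) cat_map \<Rightarrow> bool" where
  "isomorphic_to_verdier_functor C T N C' T' L \<longleftrightarrow>
     (\<exists>\<Phi>. triangulated_isomorphism (verdier_category C T N) (verdier_triangulation C T N) C' T' \<Phi> \<and>
        (\<forall>X\<in>Obj C. on_obj \<Phi> (on_obj (verdier_functor C T N) X) = on_obj L X) \<and>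
        (\<forall>X\<in>Obj C. \<forall>Y\<in>Obj C. \<forall>f\<in>Hom C X Y.
           on_mor \<Phi> X Y (on_mor (verdier_functor C T N) X Y f) = on_mor L X Y f))"


section \<open>Localization of rings and tensor products of modules\<close>

text \<open>
  \<open>fraction R S a s\<close> is the fraction \<open>a/s\<close>, the class of \<open>(a, s)\<close>. The localization is
  an \<open>R\<close>-algebra, hence a record of type \<open>module\<close>; the unions are single classes.
\<close>

definition fraction :: "('r, 'y) ring_scheme \<Rightarrow> 'r set \<Rightarrow> 'r \<Rightarrow> 'r \<Rightarrow> ('r \<times> 'r) set" where
  "fraction R S a s = {(b, t). b \<in> carrier R \<and> t \<in> S \<and>
     (\<exists>u\<in>S. u \<otimes>\<^bsub>R\<^esub> (t \<otimes>\<^bsub>R\<^esub> a) = u \<otimes>\<^bsub>R\<^esub> (s \<otimes>\<^bsub>R\<^esub> b))}"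

definition localization :: "('r, 'y) ring_scheme \<Rightarrow> 'r set \<Rightarrow> ('r, ('r \<times> 'r) set) module" where
  "localization R S =
     \<lparr>carrier = {fraction R S a s | a s. a \<in> carrier R \<and> s \<in> S},
      monoid.mult = (\<lambda>x y. \<Union>(a, s)\<in>x. \<Union>(b, t)\<in>y. fraction R S (a \<otimes>\<^bsub>R\<^esub> b) (s \<otimes>\<^bsub>R\<^esub> t)),
      one = fraction R S \<one>\<^bsub>R\<^esub> \<one>\<^bsub>R\<^esub>,
      ring.zero = fraction R S \<zero>\<^bsub>R\<^esub> \<one>\<^bsub>R\<^esub>,
      add = (\<lambda>x y. \<Union>(a, s)\<in>x. \<Union>(b, t)\<in>y.
        fraction R S (t \<otimes>\<^bsub>R\<^esub> a \<oplus>\<^bsub>R\<^esub> s \<otimes>\<^bsub>R\<^esub> b) (s \<otimes>\<^bsub>R\<^esub> t)),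
      smult = (\<lambda>r x. \<Union>(a, s)\<in>x. fraction R S (r \<otimes>\<^bsub>R\<^esub> a) s)\<rparr>"

definition localization_at :: "('r, 'y) ring_scheme \<Rightarrow> 'r set \<Rightarrow> ('r, ('r \<times> 'r) set) module" where
  "localization_at R p = localization R (carrier R - p)"

definition tensor_relations ::
  "('r, 'y) ring_scheme \<Rightarrow> ('r, 'm, 'u) module_scheme \<Rightarrow> ('r, 'n, 'v) module_scheme \<Rightarrow>
   (('m \<times> 'n) \<Rightarrow>\<^sub>0 int) set" where
  "tensor_relations R M N =
     {frag_of (m \<oplus>\<^bsub>M\<^esub> m', n) - frag_of (m, n) - frag_of (m', n) | m m' n.
        m \<in> carrier M \<and> m' \<in> carrier M \<and> n \<in> carrier N} \<union>
     {frag_of (m, n \<oplus>\<^bsub>N\<^esub> n') - frag_of (m, n) - frag_of (m, n') | m n n'.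
        m \<in> carrier M \<and> n \<in> carrier N \<and> n' \<in> carrier N} \<union>
     {frag_of (r \<odot>\<^bsub>M\<^esub> m, n) - frag_of (m, r \<odot>\<^bsub>N\<^esub> n) | r m n.
        r \<in> carrier R \<and> m \<in> carrier M \<and> n \<in> carrier N}"

definition tensor_null ::
  "('r, 'y) ring_scheme \<Rightarrow> ('r, 'm, 'u) module_scheme \<Rightarrow> ('r, 'n, 'v) module_scheme \<Rightarrow>
   (('m \<times> 'n) \<Rightarrow>\<^sub>0 int) set" where
  "tensor_null R M N =
     generate (free_Abelian_group (carrier M \<times> carrier N)) (tensor_relations R M N)"

definition tensor_product ::
  "('r, 'y) ring_scheme \<Rightarrow> ('r, 'm, 'u) module_scheme \<Rightarrow> ('r, 'n, 'v) module_scheme \<Rightarrow>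
   (('m \<times> 'n) \<Rightarrow>\<^sub>0 int) set monoid" where
  "tensor_product R M N =
     free_Abelian_group (carrier M \<times> carrier N) Mod tensor_null R M N"

definition tensor_class ::
  "('r, 'y) ring_scheme \<Rightarrow> ('r, 'm, 'u) module_scheme \<Rightarrow> ('r, 'n, 'v) module_scheme \<Rightarrow>
   (('m \<times> 'n) \<Rightarrow>\<^sub>0 int) \<Rightarrow> (('m \<times> 'n) \<Rightarrow>\<^sub>0 int) set" where
  "tensor_class R M N c = tensor_null R M N #>\<^bsub>free_Abelian_group (carrier M \<times> carrier N)\<^esub> c"

definition tensor ::
  "('r, 'y) ring_scheme \<Rightarrow> ('r, 'm, 'u) module_scheme \<Rightarrow> ('r, 'n, 'v) module_scheme \<Rightarrow>
   'm \<Rightarrow> 'n \<Rightarrow> (('m \<times> 'n) \<Rightarrow>\<^sub>0 int) set" where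
  "tensor R M N m n = tensor_class R M N (frag_of (m, n))"


section \<open>Localization of a linear category at a maximal ideal\<close>

text \<open>
  The category \<open>C\<^sub>p\<close> has morphisms \<open>C(X, Y) \<otimes>\<^sub>R R\<^sub>p\<close> and is \<open>R\<^sub>p\<close>-linear. Composition is the bilinear extension
  of \<open>(g \<otimes> x) \<circ> (f \<otimes> y) = (g \<circ> f) \<otimes> xy\<close>, and scalars act by \<open>x (f \<otimes> y) = f \<otimes> xy\<close>. As before, the
  unions are single classes.
\<close>

definition loc_category ::
  "('r, 'y) ring_scheme \<Rightarrow> 'r set \<Rightarrow> ('o, 'm, 'r, 'x) linear_category_scheme \<Rightarrow>
   ('o, (('m \<times> ('r \<times> 'r) set) \<Rightarrow>\<^sub>0 int) set, ('r \<times> 'r) set) linear_category" where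
  "loc_category R p C =
     \<lparr>Obj = Obj C,
      Hom = (\<lambda>X Y. carrier (tensor_product R (hom_module C X Y) (localization_at R p))),
      Ident = (\<lambda>X. tensor R (hom_module C X X) (localization_at R p)
        (Ident C X) \<one>\<^bsub>localization_at R p\<^esub>),
      Comp = (\<lambda>X Y Z \<beta> \<alpha>. \<Union>d\<in>\<beta>. \<Union>c\<in>\<alpha>.
        tensor_class R (hom_module C X Z) (localization_at R p)
          (frag_extend (\<lambda>(g, x). frag_extend (\<lambda>(f, y).
             frag_of (Comp C X Y Z g f, x \<otimes>\<^bsub>localization_at R p\<^esub> y)) c) d)),
      Add = (\<lambda>X Y. monoid.mult (tensor_product R (hom_module C X Y) (localization_at R p))),
      Zero = (\<lambda>X Y. one (tensor_product R (hom_module C X Y) (localization_at R p))),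
      Scale = (\<lambda>X Y x \<alpha>. \<Union>c\<in>\<alpha>.
        tensor_class R (hom_module C X Y) (localization_at R p)
          (frag_extend (\<lambda>(f, y). frag_of (f, x \<otimes>\<^bsub>localization_at R p\<^esub> y)) c))\<rparr>"

definition loc_functor ::
  "('r, 'y) ring_scheme \<Rightarrow> 'r set \<Rightarrow> ('o, 'm, 'r, 'x) linear_category_scheme \<Rightarrow>
   ('o, 'm, 'o, (('m \<times> ('r \<times> 'r) set) \<Rightarrow>\<^sub>0 int) set) cat_map" where
  "loc_functor R p C =
     \<lparr>on_obj = (\<lambda>X. X),
      on_mor = (\<lambda>X Y f. tensor R (hom_module C X Y) (localization_at R p)
        f \<one>\<^bsub>localization_at R p\<^esub>)\<rparr>"

text \<open>All cones of \<open>s id\<^sub>X\<close> are included; they are isomorphic to one another.\<close>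

definition scalar_cones ::
  "('r, 'y) ring_scheme \<Rightarrow> 'r set \<Rightarrow> ('o, 'm, 'r, 'x) linear_category_scheme \<Rightarrow>
   ('o, 'm, 'z) triangulation_scheme \<Rightarrow> 'o set" where
  "scalar_cones R p C T = {Z. \<exists>s\<in>carrier R - p. \<exists>X\<in>Obj C. \<exists>g h.
     (X, X, Z, Scale C X X s (Ident C X), g, h) \<in> triangles T}"

text \<open>
  \<open>T'\<close> is the triangulated structure on \<open>C\<^sub>p\<close> for which \<open>L\<^sub>p\<close> is isomorphic to the Verdier quotient
  functor. Since the isomorphism strictly commutes with the functors from \<open>C\<close> and with the shifts, \<open>T'\<close> is
  determined on the objects and morphisms of \<open>C\<^sub>p\<close>.
\<close>

definition is_loc_triangulation ::
  "('r, 'y) ring_scheme \<Rightarrow> 'r set \<Rightarrow> ('o, 'm, 'r, 'x) linear_category_scheme \<Rightarrow>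
   ('o, 'm, 'z) triangulation_scheme \<Rightarrow>
   ('o, (('m \<times> ('r \<times> 'r) set) \<Rightarrow>\<^sub>0 int) set) triangulation \<Rightarrow> bool" where
  "is_loc_triangulation R p C T T' \<longleftrightarrow>
     is_linear_triangulated_category (localization_at R p) (loc_category R p C) T' \<and>
     isomorphic_to_verdier_functor C T (generated_subcategory C T (scalar_cones R p C T))
       (loc_category R p C) T' (loc_functor R p C)"

end

theory Submission
  imports Defs "HOL-Algebra.Ring_Divisibility"
begin

text \<open>
  Let \<open>E\<close> be the envelope of \<open>D\<close> in \<open>C\<close>. The ideal that carries the proof is
  \<open>I = {r. r id\<^sub>Y factors through an object of E}\<close>. It is closed under multiplication by
  scalars trivially and under sums because \<open>E\<close> contains the biproducts of its objects
  (\<open>scalar_factors_ideal\<close>), and \<open>1 \<in> I\<close> means that \<open>Y\<close> is a retract of an object of \<open>E\<close>. So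
  \<open>Y \<in> E\<close> as soon as \<open>I\<close> lies in no maximal ideal, that is, as soon as every maximal ideal \<open>p\<close>
  admits some \<open>r \<notin> p\<close> for which \<open>r id\<^sub>Y\<close> factors through \<open>E\<close>.

  For fixed \<open>p\<close>, let \<open>P\<close> be the class of all objects with such an \<open>r\<close>. It contains \<open>D\<close>; if
  it is closed in \<open>C\<^sub>p\<close> under extensions and retracts, it contains the whole envelope of \<open>L\<^sub>p(D)\<close>,
  and the implication from local to global follows (\<open>envelope_local\<close>). Retracts are dealt with by
  clearing denominators. Extensions need the one real idea of the proof
  (\<open>scalar_factors_extension\<close>): if \<open>r id\<^sub>A\<close> and \<open>s id\<^sub>B\<close> factor through \<open>E\<close> and
  \<open>A \<rightarrow> X \<rightarrow> B\<close> is distinguished in \<open>C\<close>, the two factorizations assemble to an endomorphism \<open>\<phi>\<close> of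
  \<open>X\<close> that factors through \<open>E\<close> and agrees with \<open>rs\<close> up to some \<open>n\<close> with \<open>n\<^sup>2 = 0\<close>, whence
  \<open>(rs)\<^sup>2 id\<^sub>X = \<phi>(rs - n)\<close> factors through \<open>E\<close> as well.

  The converse implication only uses that \<open>L\<^sub>p\<close> is exact (\<open>envelope_image\<close>).

  About \<open>C\<^sub>p\<close> it therefore suffices to know: \<open>L\<^sub>p\<close> is an exact functor; every distinguished triangle of \<open>C\<^sub>p\<close>
  is isomorphic to the image of one of \<open>C\<close>; every morphism of \<open>C\<^sub>p\<close> becomes a morphism of \<open>C\<close> after
  multiplication by some \<open>u \<notin> p\<close>; and morphisms of \<open>C\<close> that agree in \<open>C\<^sub>p\<close> agree after multiplication
  by some \<open>u \<notin> p\<close>. All this is read off the comparison with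
  the Verdier quotient. The last two properties hold because every object of the subcategory generated by
  the cones of the scalars outside \<open>p\<close> is annihilated by a scalar outside \<open>p\<close>: an object annihilated by
  \<open>u\<close> can be cut out of exact sequences at the price of the factor \<open>u\<close>.
\<close>

section \<open>Linear categories\<close>

context is_category
begin

lemmas cat_simps = Ident_closed Comp_closed Comp_Ident_right Comp_Ident_left

lemma iso_morE:
  assumes "iso_mor C X Y u"
  obtains v where "u \<in> Hom C X Y" "v \<in> Hom C Y X"
    "Comp C X Y X v u = Ident C X" "Comp C Y X Y u v = Ident C Y"
  using assms unfolding iso_mor_def by blast

lemma iso_mor_sym:
  assumes "iso_mor C X Y u"
  obtains v where "iso_mor C Y X v"
    "Comp C X Y X v u = Ident C X" "Comp C Y X Y u v = Ident C Y"
  using assms unfolding iso_mor_def by blast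

lemma iso_mor_Ident: "X \<in> Obj C \<Longrightarrow> iso_mor C X X (Ident C X)"
  unfolding iso_mor_def by (auto simp: cat_simps)

lemma iso_mor_retract:
  "\<lbrakk>X \<in> Obj C; Y \<in> Obj C; iso_mor C X Y u\<rbrakk> \<Longrightarrow> retract C X Y"
  unfolding iso_mor_def retract_def by blast

end

context is_linear_category
begin

abbreviation Neg where
  "Neg X Y f \<equiv> \<ominus>\<^bsub>hom_module C X Y\<^esub> f"

lemma hom_module_fields:
  "carrier (hom_module C X Y) = Hom C X Y" "ring.zero (hom_module C X Y) = Zero C X Y"
  "add (hom_module C X Y) = Add C X Y" "smult (hom_module C X Y) = Scale C X Y"
  by (simp_all add: hom_module_def)

sublocale scalars: cring R by (rule cring_scalars)

context
  fixes X Y assumes obj: "X \<in> Obj C" "Y \<in> Obj C"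
begin

interpretation M: Module.module R "hom_module C X Y" by (rule hom_module[OF obj])

lemma Add_closed: "\<lbrakk>f \<in> Hom C X Y; g \<in> Hom C X Y\<rbrakk> \<Longrightarrow> Add C X Y f g \<in> Hom C X Y"
  using M.add.m_closed[of f g] by (simp add: hom_module_fields)

lemma Zero_closed: "Zero C X Y \<in> Hom C X Y"
  using M.zero_closed by (simp add: hom_module_fields)

lemma Neg_closed: "f \<in> Hom C X Y \<Longrightarrow> Neg X Y f \<in> Hom C X Y"
  using M.a_inv_closed[of f] by (simp add: hom_module_fields)

lemma Scale_closed: "\<lbrakk>r \<in> carrier R; f \<in> Hom C X Y\<rbrakk> \<Longrightarrow> Scale C X Y r f \<in> Hom C X Y"
  using M.smult_closed[of r f] by (simp add: hom_module_fields)

lemma Add_Zero_right: "f \<in> Hom C X Y \<Longrightarrow> Add C X Y f (Zero C X Y) = f"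
  using M.r_zero[of f] by (simp add: hom_module_fields)

lemma Add_Zero_left: "f \<in> Hom C X Y \<Longrightarrow> Add C X Y (Zero C X Y) f = f"
  using M.l_zero[of f] by (simp add: hom_module_fields)

lemma Add_Neg_right: "f \<in> Hom C X Y \<Longrightarrow> Add C X Y f (Neg X Y f) = Zero C X Y"
  using M.r_neg[of f] by (simp add: hom_module_fields)

lemma Neg_Neg: "f \<in> Hom C X Y \<Longrightarrow> Neg X Y (Neg X Y f) = f"
  using M.minus_minus[of f] by (simp add: hom_module_fields)

lemma Neg_Zero: "Neg X Y (Zero C X Y) = Zero C X Y"
  by (metis Add_Neg_right Add_Zero_left Neg_closed Zero_closed)

lemma Neg_inj: "\<lbrakk>f \<in> Hom C X Y; g \<in> Hom C X Y; Neg X Y f = Neg X Y g\<rbrakk> \<Longrightarrow> f = g"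
  using Neg_Neg by metis

lemma Neg_Scale: "\<lbrakk>r \<in> carrier R; f \<in> Hom C X Y\<rbrakk>
    \<Longrightarrow> Scale C X Y r (Neg X Y f) = Neg X Y (Scale C X Y r f)"
  using M.smult_r_minus[of r f] by (simp add: hom_module_fields)

lemma Neg_conv_Scale: "f \<in> Hom C X Y \<Longrightarrow> Neg X Y f = Scale C X Y (\<ominus>\<^bsub>R\<^esub> \<one>\<^bsub>R\<^esub>) f"
  using M.smult_l_minus[of "\<one>\<^bsub>R\<^esub>" f] M.smult_one[of f] by (simp add: hom_module_fields)

lemma Scale_zero_right: "r \<in> carrier R \<Longrightarrow> Scale C X Y r (Zero C X Y) = Zero C X Y"
  using M.smult_r_null[of r] by (simp add: hom_module_fields)

lemma Scale_zero_left: "f \<in> Hom C X Y \<Longrightarrow> Scale C X Y \<zero>\<^bsub>R\<^esub> f = Zero C X Y"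
  using M.smult_l_null[of f] by (simp add: hom_module_fields)

lemma Scale_one: "f \<in> Hom C X Y \<Longrightarrow> Scale C X Y \<one>\<^bsub>R\<^esub> f = f"
  using M.smult_one[of f] by (simp add: hom_module_fields)

lemma Scale_Scale: "\<lbrakk>r \<in> carrier R; s \<in> carrier R; f \<in> Hom C X Y\<rbrakk>
    \<Longrightarrow> Scale C X Y r (Scale C X Y s f) = Scale C X Y (r \<otimes>\<^bsub>R\<^esub> s) f"
  using M.smult_assoc1[of r s f] by (simp add: hom_module_fields)

lemma Scale_add_left: "\<lbrakk>r \<in> carrier R; s \<in> carrier R; f \<in> Hom C X Y\<rbrakk>
    \<Longrightarrow> Scale C X Y (r \<oplus>\<^bsub>R\<^esub> s) f = Add C X Y (Scale C X Y r f) (Scale C X Y s f)"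
  using M.smult_l_distr[of r s f] by (simp add: hom_module_fields)

lemma Scale_add_right: "\<lbrakk>r \<in> carrier R; f \<in> Hom C X Y; g \<in> Hom C X Y\<rbrakk>
    \<Longrightarrow> Scale C X Y r (Add C X Y f g) = Add C X Y (Scale C X Y r f) (Scale C X Y r g)"
  using M.smult_r_distr[of r f g] by (simp add: hom_module_fields)

lemma Add_Neg_eq_Zero:
  assumes "f \<in> Hom C X Y" "g \<in> Hom C X Y" "Add C X Y f (Neg X Y g) = Zero C X Y"
  shows "f = g"
  using assms M.r_neg1[of g f] M.minus_equality
  by (metis hom_module_fields Neg_closed M.minus_minus)

end

lemma Comp_Zero_right: "\<lbrakk>X \<in> Obj C; Y \<in> Obj C; Z \<in> Obj C; g \<in> Hom C Y Z\<rbrakk>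
    \<Longrightarrow> Comp C X Y Z g (Zero C X Y) = Zero C X Z"
  by (metis Comp_Scale_right Comp_closed Scale_zero_left Zero_closed scalars.zero_closed)

lemma Comp_Zero_left: "\<lbrakk>X \<in> Obj C; Y \<in> Obj C; Z \<in> Obj C; f \<in> Hom C X Y\<rbrakk>
    \<Longrightarrow> Comp C X Y Z (Zero C Y Z) f = Zero C X Z"
  by (metis Comp_Scale_left Comp_closed Scale_zero_left Zero_closed scalars.zero_closed)

lemma Comp_Neg_right: "\<lbrakk>X \<in> Obj C; Y \<in> Obj C; Z \<in> Obj C; f \<in> Hom C X Y; g \<in> Hom C Y Z\<rbrakk>
    \<Longrightarrow> Comp C X Y Z g (Neg X Y f) = Neg X Z (Comp C X Y Z g f)"
  by (simp add: Neg_conv_Scale Comp_Scale_right Comp_closed)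

lemma Comp_Neg_left: "\<lbrakk>X \<in> Obj C; Y \<in> Obj C; Z \<in> Obj C; f \<in> Hom C X Y; g \<in> Hom C Y Z\<rbrakk>
    \<Longrightarrow> Comp C X Y Z (Neg Y Z g) f = Neg X Z (Comp C X Y Z g f)"
  by (simp add: Neg_conv_Scale Comp_Scale_left Comp_closed)

lemmas lin_simps = cat_simps Add_closed Zero_closed Neg_closed Scale_closed
  Comp_Zero_right Comp_Zero_left Comp_Neg_right Comp_Neg_left Comp_Scale_left Comp_Scale_right
  Neg_Neg Neg_Zero Scale_zero_right Scale_one Scale_Scale Add_Zero_left Add_Zero_right

lemma zero_object_iff: "zero_object C Z \<longleftrightarrow> Z \<in> Obj C \<and> Ident C Z = Zero C Z Z"
proof
  assume "Z \<in> Obj C \<and> Ident C Z = Zero C Z Z"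
  then have Z: "Z \<in> Obj C" and eq: "Ident C Z = Zero C Z Z" by auto
  have "f = Zero C X Z" if "X \<in> Obj C" "f \<in> Hom C X Z" for X f
    using that Z eq Comp_Ident_left[of X Z f] Comp_Zero_left[of X Z Z f] by simp
  moreover have "f = Zero C Z X" if "X \<in> Obj C" "f \<in> Hom C Z X" for X f
    using that Z eq Comp_Ident_right[of Z X f] Comp_Zero_right[of Z Z X f] by simp
  ultimately show "zero_object C Z"
    unfolding zero_object_def using Z Zero_closed by metis
qed (auto simp: zero_object_def intro: Ident_closed Zero_closed)

end

section \<open>Exact sequences and fill-ins in triangulated categories\<close>

context is_linear_triangulated_category
begin

abbreviation "Tr \<equiv> triangles T"

lemma sh_obj: "X \<in> Obj C \<Longrightarrow> sh T X \<in> Obj C"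
  and sh_Ident: "X \<in> Obj C \<Longrightarrow> sh_mor T X X (Ident C X) = Ident C (sh T X)"
  and sh_closed: "\<lbrakk>X \<in> Obj C; Y \<in> Obj C; f \<in> Hom C X Y\<rbrakk> \<Longrightarrow> sh_mor T X Y f \<in> Hom C (sh T X) (sh T Y)"
  and sh_Comp: "\<lbrakk>X \<in> Obj C; Y \<in> Obj C; Z \<in> Obj C; f \<in> Hom C X Y; g \<in> Hom C Y Z\<rbrakk>
    \<Longrightarrow> sh_mor T X Z (Comp C X Y Z g f) =
      Comp C (sh T X) (sh T Y) (sh T Z) (sh_mor T Y Z g) (sh_mor T X Y f)"
  using shift_functor unfolding is_functor_def shift_map_def by auto

lemma sh_inj: "\<lbrakk>X \<in> Obj C; Y \<in> Obj C; f \<in> Hom C X Y; g \<in> Hom C X Y;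
    sh_mor T X Y f = sh_mor T X Y g\<rbrakk> \<Longrightarrow> f = g"
  using shift_fully_faithful unfolding fully_faithful_def shift_map_def bij_betw_def inj_on_def
  by auto

lemma sh_full:
  assumes "X \<in> Obj C" "Y \<in> Obj C" "f \<in> Hom C (sh T X) (sh T Y)"
  obtains g where "g \<in> Hom C X Y" "f = sh_mor T X Y g"
proof -
  have "sh_mor T X Y ` Hom C X Y = Hom C (sh T X) (sh T Y)"
    using assms shift_fully_faithful unfolding fully_faithful_def shift_map_def bij_betw_def by simp
  then show thesis using that assms(3) by blast
qed

lemma sh_Zero: "\<lbrakk>X \<in> Obj C; Y \<in> Obj C\<rbrakk> \<Longrightarrow> sh_mor T X Y (Zero C X Y) = Zero C (sh T X) (sh T Y)"
  by (metis Scale_zero_left Zero_closed scalars.zero_closed sh_closed sh_obj shift_Scale)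

lemma sh_Neg: "\<lbrakk>X \<in> Obj C; Y \<in> Obj C; f \<in> Hom C X Y\<rbrakk>
    \<Longrightarrow> sh_mor T X Y (Neg X Y f) = Neg (sh T X) (sh T Y) (sh_mor T X Y f)"
  by (simp add: Neg_conv_Scale shift_Scale sh_closed sh_obj)

lemmas tri_simps = lin_simps sh_obj sh_closed sh_Ident sh_Zero sh_Neg

lemma triangle_parts:
  assumes "(X, Y, Z, f, g, h) \<in> Tr"
  shows "X \<in> Obj C" "Y \<in> Obj C" "Z \<in> Obj C" "f \<in> Hom C X Y" "g \<in> Hom C Y Z"
    "h \<in> Hom C Z (sh T X)"
  using triangles[OF assms] by auto

lemma rotate: "(X, Y, Z, f, g, h) \<in> Tr
    \<Longrightarrow> (Y, Z, sh T X, g, h, Neg (sh T X) (sh T Y) (sh_mor T X Y f)) \<in> Tr"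
  using TR2 triangles by blast

text \<open>
  A triangle can be turned back only if its third object is literally a shift. As the shift is merely
  an equivalence, triangles of this form have to be produced first (\<open>ex_fibre_of_cone\<close>).
\<close>

lemma unrotate:
  assumes "(Y, Z, sh T X, g, h, Neg (sh T X) (sh T Y) (sh_mor T X Y f)) \<in> Tr"
    "X \<in> Obj C" "f \<in> Hom C X Y"
  shows "(X, Y, Z, f, g, h) \<in> Tr"
  using assms TR2[of X Y Z f g h] triangle_parts[OF assms(1)] by simp

lemma ex_zero: obtains O' where "zero_object C O'" "O' \<in> Obj C"
  using ex_zero_object unfolding zero_object_def by blast

lemma zero_object_sh: "zero_object C Z \<Longrightarrow> zero_object C (sh T Z)"
  by (metis sh_Ident sh_Zero sh_obj zero_object_iff)

lemma zero_triangle_left: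
  assumes "zero_object C O'" "W \<in> Obj C"
  shows "(O', W, W, Zero C O' W, Ident C W, Zero C W (sh T O')) \<in> Tr"
proof (rule unrotate)
  have O: "O' \<in> Obj C" using assms(1) by (simp add: zero_object_def)
  then show "O' \<in> Obj C" "Zero C O' W \<in> Hom C O' W" using assms(2) by (simp_all add: tri_simps)
  show "(W, W, sh T O', Ident C W, Zero C W (sh T O'),
      Neg (sh T O') (sh T W) (sh_mor T O' W (Zero C O' W))) \<in> Tr"
    using TR1_id[OF assms(2) zero_object_sh[OF assms(1)]] O assms(2) by (simp add: tri_simps)
qed

lemma zero_triangle_right:
  assumes "zero_object C O'" "W \<in> Obj C"
  shows "(W, O', sh T W, Zero C W O', Zero C O' (sh T W), Neg (sh T W) (sh T W) (Ident C (sh T W))) \<in> Tr"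
proof -
  have O: "O' \<in> Obj C" using assms(1) by (simp add: zero_object_def)
  show ?thesis
    using rotate[OF TR1_id[OF assms(2,1)]] O assms(2) by (simp add: tri_simps)
qed

lemma triangle_comp_zero:
  assumes "(X, Y, Z, f, g, h) \<in> Tr"
  shows "Comp C X Y Z g f = Zero C X Z"
proof -
  note p = triangle_parts[OF assms]
  obtain O' where O: "zero_object C O'" "O' \<in> Obj C" by (rule ex_zero)
  obtain c where "triangle_mor C T (X, X, O', Ident C X, Zero C X O', Zero C O' (sh T X))
      (X, Y, Z, f, g, h) (Ident C X, f, c)"
    using TR3[OF TR1_id[OF p(1) O(1)] assms, of "Ident C X" f] p by (auto simp: tri_simps)
  then show ?thesis using p O by (auto simp: tri_simps)
qed

text \<open>
  Exactness of \<open>Hom(-, W)\<close>, obtained by filling in a map to the triangle \<open>0 \<rightarrow> W \<rightarrow> W \<rightarrow> 0[1]\<close>.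
\<close>

lemma factor_through_cone:
  assumes "(X, Y, Z, f, g, h) \<in> Tr" "W \<in> Obj C" "k \<in> Hom C Y W" "Comp C X Y W k f = Zero C X W"
  obtains l where "l \<in> Hom C Z W" "k = Comp C Y Z W l g"
proof -
  note p = triangle_parts[OF assms(1)]
  obtain O' where O: "zero_object C O'" "O' \<in> Obj C" by (rule ex_zero)
  obtain c where "triangle_mor C T (X, Y, Z, f, g, h)
      (O', W, W, Zero C O' W, Ident C W, Zero C W (sh T O')) (Zero C X O', k, c)"
    using TR3[OF assms(1) zero_triangle_left[OF O(1) assms(2)], of "Zero C X O'" k] p O assms
    by (auto simp: tri_simps)
  then show ?thesis using p O assms that[of c] by (auto simp: tri_simps)
qed

text \<open>
  Exactness of \<open>Hom(W, -)\<close>, obtained by filling in a map from the triangle \<open>W \<rightarrow> 0 \<rightarrow> W[1] \<rightarrow> W[1]\<close>; the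
  fill-in is a map between shifts and descends because the shift is full and faithful.
\<close>

lemma factor_through_fibre:
  assumes "(X, Y, Z, f, g, h) \<in> Tr" "W \<in> Obj C" "k \<in> Hom C W Y" "Comp C W Y Z g k = Zero C W Z"
  obtains l where "l \<in> Hom C W X" "k = Comp C W X Y f l"
proof -
  note p = triangle_parts[OF assms(1)]
  obtain O' where O: "zero_object C O'" "O' \<in> Obj C" by (rule ex_zero)
  obtain c where c: "triangle_mor C T (W, O', sh T W, Zero C W O', Zero C O' (sh T W),
      Neg (sh T W) (sh T W) (Ident C (sh T W)))
      (Y, Z, sh T X, g, h, Neg (sh T X) (sh T Y) (sh_mor T X Y f)) (k, Zero C O' Z, c)"
    using TR3[OF zero_triangle_right[OF O(1) assms(2)] rotate[OF assms(1)], of k "Zero C O' Z"]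
      p O assms by (auto simp: tri_simps)
  then obtain l where l: "l \<in> Hom C W X" "c = sh_mor T W X l"
    using p assms sh_full[of W X c] by auto
  have "Neg (sh T W) (sh T Y) (sh_mor T W Y k) = Neg (sh T W) (sh T Y) (sh_mor T W Y (Comp C W X Y f l))"
    using c l p assms O by (auto simp: tri_simps sh_Comp)
  from Neg_inj[OF _ _ _ _ this] have "sh_mor T W Y k = sh_mor T W Y (Comp C W X Y f l)"
    using p assms l by (simp add: tri_simps)
  then have "k = Comp C W X Y f l"
    by (rule sh_inj[rotated 4]) (use p assms l in \<open>simp_all add: tri_simps\<close>)
  then show ?thesis using that l by blast
qed

lemma shift_preimage:
  assumes "W \<in> Obj C" obtains X u v where "X \<in> Obj C" "u \<in> Hom C (sh T X) W" "v \<in> Hom C W (sh T X)"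
    "Comp C (sh T X) W (sh T X) v u = Ident C (sh T X)" "Comp C W (sh T X) W u v = Ident C W"
  using shift_ess_surj[OF assms] unfolding iso_mor_def by blast

text \<open>
  A cone \<open>W\<close> of \<open>g\<close> is isomorphic to some \<open>X[1]\<close>, and \<open>X\<close> is then a fibre of \<open>g\<close>. The isomorphism is kept
  in the conclusion because membership of \<open>X\<close> in a triangulated subcategory is inferred from that of \<open>W\<close>.
\<close>

lemma ex_fibre_of_cone:
  assumes "(Y, Z, W, g, a, b) \<in> Tr"
  obtains X f h u where "(X, Y, Z, f, g, h) \<in> Tr" "iso_mor C W (sh T X) u"
proof -
  note p = triangle_parts[OF assms]
  obtain X u v where X: "X \<in> Obj C" and u: "u \<in> Hom C (sh T X) W" and v: "v \<in> Hom C W (sh T X)"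
    and vu: "Comp C (sh T X) W (sh T X) v u = Ident C (sh T X)"
    and uv: "Comp C W (sh T X) W u v = Ident C W"
    by (rule shift_preimage[OF p(3)])
  define h where "h = Comp C Z W (sh T X) v a"
  have isov: "iso_mor C W (sh T X) v" using u v vu uv by (auto simp: iso_mor_def)
  have bu: "Comp C (sh T X) W (sh T Y) b u \<in> Hom C (sh T X) (sh T Y)" using p u X by (simp add: tri_simps)
  obtain f' where f': "f' \<in> Hom C X Y" "Comp C (sh T X) W (sh T Y) b u = sh_mor T X Y f'"
    by (rule sh_full[OF X p(1) bu])
  have h: "h \<in> Hom C Z (sh T X)" using p v X by (simp add: h_def tri_simps)
  have b: "b = Comp C W (sh T X) (sh T Y) (Comp C (sh T X) W (sh T Y) b u) v"
    using Comp_assoc[of W "sh T X" W "sh T Y" v u b] p u v X uv by (simp add: tri_simps)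
  have "triangle_iso C T (Y, Z, W, g, a, b) (Y, Z, sh T X, g, h, Comp C (sh T X) W (sh T Y) b u)"
    unfolding triangle_iso.simps
    by (rule exI[of _ "Ident C Y"], rule exI[of _ "Ident C Z"], rule exI[of _ v])
      (use b p isov v X iso_mor_Ident in \<open>simp add: tri_simps h_def\<close>)
  then have "(Y, Z, sh T X, g, h, sh_mor T X Y f') \<in> Tr"
    using TR1_iso[OF assms] p X h bu f' by (auto simp: tri_simps)
  then have "(Y, Z, sh T X, g, h, Neg (sh T X) (sh T Y) (sh_mor T X Y (Neg X Y f'))) \<in> Tr"
    using p X f' by (simp add: tri_simps)
  then have "(X, Y, Z, Neg X Y f', g, h) \<in> Tr"
    using X p f' by (blast intro: unrotate Neg_closed)
  then show ?thesis using that isov by blast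
qed

lemma ex_fibre:
  assumes "Y \<in> Obj C" "Z \<in> Obj C" "g \<in> Hom C Y Z"
  obtains X f h where "(X, Y, Z, f, g, h) \<in> Tr"
proof -
  obtain W a b where W: "(Y, Z, W, g, a, b) \<in> Tr" using TR1_cone[OF assms] by blast
  show thesis by (rule ex_fibre_of_cone[OF W]) (rule that)
qed

lemma rotate2:
  assumes "(A, X, B, f, g, h) \<in> Tr"
  shows "(B, sh T A, sh T X, h, Neg (sh T A) (sh T X) (sh_mor T A X f),
    Neg (sh T X) (sh T B) (sh_mor T X B g)) \<in> Tr"
  using rotate[OF rotate[OF assms]] .

text \<open>
  Every class in \<open>Hom(B, A[1])\<close> is the connecting map of an extension of \<open>B\<close> by \<open>A\<close>.
\<close>

lemma ex_extension:
  assumes "A \<in> Obj C" "B \<in> Obj C" "h \<in> Hom C B (sh T A)"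
  obtains X f g where "(A, X, B, f, g, h) \<in> Tr"
proof -
  obtain W a b where W: "(B, sh T A, W, h, a, b) \<in> Tr" using TR1_cone[of B "sh T A" h] assms sh_obj by blast
  obtain X g k where X: "(X, B, sh T A, g, h, k) \<in> Tr" by (rule ex_fibre_of_cone[OF W])
  note p = triangle_parts[OF X]
  obtain f' where f': "f' \<in> Hom C A X" "k = sh_mor T A X f'"
    by (rule sh_full[OF assms(1) p(1) p(6)])
  have "(A, X, B, Neg A X f', g, h) \<in> Tr"
    by (rule unrotate) (use X f' p assms  in \<open>auto simp: tri_simps\<close>)
  then show ?thesis using that by blast
qed

text \<open>
  The axiom \<open>TR3\<close> fills in the third map of a morphism of triangles; after two rotations the missing map
  is the shift of the middle one.
\<close>

lemma ex_middle_morphism: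
  assumes t: "(A, X, B, f, g, h) \<in> Tr" and t': "(A', X', B', f', g', h') \<in> Tr"
    and a: "a \<in> Hom C A A'" and b: "b \<in> Hom C B B'"
    and sq: "Comp C B (sh T A) (sh T A') (sh_mor T A A' a) h = Comp C B B' (sh T A') h' b"
  obtains x where "x \<in> Hom C X X'" "Comp C A X X' x f = Comp C A A' X' f' a"
    "Comp C X X' B' g' x = Comp C X B B' b g"
proof -
  note p = triangle_parts[OF t] triangle_parts[OF t']
  obtain c where c: "c \<in> Hom C (sh T X) (sh T X')"
    and c1: "Comp C (sh T A) (sh T X) (sh T X') c (Neg (sh T A) (sh T X) (sh_mor T A X f)) =
      Comp C (sh T A) (sh T A') (sh T X') (Neg (sh T A') (sh T X') (sh_mor T A' X' f')) (sh_mor T A A' a)"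
    and c2: "Comp C (sh T X) (sh T B) (sh T B') (sh_mor T B B' b) (Neg (sh T X) (sh T B) (sh_mor T X B g)) =
      Comp C (sh T X) (sh T X') (sh T B') (Neg (sh T X') (sh T B') (sh_mor T X' B' g')) c"
    using TR3[OF rotate2[OF t] rotate2[OF t'] b sh_closed[OF p(1) p(7) a] sq] by auto
  obtain x where x: "x \<in> Hom C X X'" "c = sh_mor T X X' x" by (rule sh_full[OF p(2) p(8) c])
  have "Comp C A X X' x f = Comp C A A' X' f' a"
  proof (rule sh_inj[of A X'], goal_cases)
    case 5 show ?case
      by (rule Neg_inj[of "sh T A" "sh T X'"]) (use c1 x p a in \<open>auto simp: tri_simps sh_Comp\<close>)
  qed (use p a x in \<open>auto simp: tri_simps\<close>)
  moreover have "Comp C X X' B' g' x = Comp C X B B' b g"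
  proof (rule sh_inj[of X B'], goal_cases)
    case 5 show ?case
      by (rule Neg_inj[of "sh T X" "sh T B'"]) (use c2 x p b in \<open>auto simp: tri_simps sh_Comp\<close>)
  qed (use p b x in \<open>auto simp: tri_simps\<close>)
  ultimately show ?thesis using that x by blast
qed

end

section \<open>Calculus of fractions in a Verdier quotient\<close>

lemma Union_eq_if_subset_singleton: "\<lbrakk>A \<subseteq> {x}; y \<in> A\<rbrakk> \<Longrightarrow> \<Union>A = x"
  by blast

locale verdier_quotient = is_linear_triangulated_category R C T
  for R :: "('r, 'y) ring_scheme"
    and C :: "('o, 'm, 'r, 'x) linear_category_scheme"
    and T :: "('o, 'm, 'z) triangulation_scheme" +
  fixes N :: "'o set"
  assumes subcategory: "triangulated_subcategory C T N"
begin

abbreviation "S \<equiv> mor_with_cone_in C T N"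

lemma N_zero: "zero_object C X \<Longrightarrow> X \<in> N"
  and N_iso: "\<lbrakk>X \<in> N; Y \<in> Obj C; iso_mor C X Y u\<rbrakk> \<Longrightarrow> Y \<in> N"
  and N_sh: "X \<in> Obj C \<Longrightarrow> sh T X \<in> N \<longleftrightarrow> X \<in> N"
  and N_cone: "\<lbrakk>(X, Y, Z, f, g, h) \<in> Tr; X \<in> N; Y \<in> N\<rbrakk> \<Longrightarrow> Z \<in> N"
  using subcategory unfolding triangulated_subcategory_def by blast+

lemma N_extension:
  assumes "(A, X, B, f, g, h) \<in> Tr" "A \<in> N" "B \<in> N"
  shows "X \<in> N"
  using N_cone[OF rotate2[OF assms(1)]] assms N_sh triangle_parts(1,2)[OF assms(1)] by simp

lemma S_Hom: "f \<in> S X Y \<Longrightarrow> f \<in> Hom C X Y"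
  by (simp add: mor_with_cone_in_def)

lemma S_I: "\<lbrakk>(X, Y, Z, f, g, h) \<in> Tr; Z \<in> N\<rbrakk> \<Longrightarrow> f \<in> S X Y"
  using triangle_parts(4) unfolding mor_with_cone_in_def by blast

lemma S_E:
  assumes "f \<in> S X Y"
  obtains Z g h where "(X, Y, Z, f, g, h) \<in> Tr" "Z \<in> N"
  using assms unfolding mor_with_cone_in_def by blast

lemma S_Ident:
  assumes "X \<in> Obj C" shows "Ident C X \<in> S X X"
proof -
  obtain O' where "zero_object C O'" "O' \<in> Obj C" by (rule ex_zero)
  then show ?thesis using S_I[OF TR1_id[OF assms]] N_zero by blast
qed

text \<open>
  By the octahedral axiom the cone of a composite is an extension of the two cones.
\<close>

lemma S_Comp:
  assumes "f \<in> S X Y" "g \<in> S Y Z"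
  shows "Comp C X Y Z g f \<in> S X Z"
proof -
  obtain Q1 p1 d1 where t1: "(X, Y, Q1, f, p1, d1) \<in> Tr" "Q1 \<in> N" using assms(1) by (rule S_E)
  obtain Q3 p3 d3 where t3: "(Y, Z, Q3, g, p3, d3) \<in> Tr" "Q3 \<in> N" using assms(2) by (rule S_E)
  note p = triangle_parts[OF t1(1)] triangle_parts[OF t3(1)]
  obtain Q2 p2 d2 where t2: "(X, Z, Q2, Comp C X Y Z g f, p2, d2) \<in> Tr"
    using TR1_cone[of X Z "Comp C X Y Z g f"] p Comp_closed by blast
  obtain a b where "(Q1, Q2, Q3, a, b, Comp C Q3 (sh T Y) (sh T Q1) (sh_mor T Y Q1 p1) d3) \<in> Tr"
    using TR4[OF p(1,2) p(8) p(4) p(10) t1(1) t2 t3(1)] by blast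
  then have "Q2 \<in> N" using N_extension t1 t3 by blast
  then show ?thesis using S_I t2 by blast
qed

lemma S_Neg:
  assumes "X \<in> Obj C" "Y \<in> Obj C" "f \<in> S X Y"
  shows "Neg X Y f \<in> S X Y"
proof -
  have "Neg X X (Ident C X) \<in> S X X"
  proof -
    obtain O' where O: "zero_object C O'" "O' \<in> Obj C" by (rule ex_zero)
    have "triangle_iso C T (X, X, O', Ident C X, Zero C X O', Zero C O' (sh T X))
        (X, X, O', Neg X X (Ident C X), Zero C X O', Zero C O' (sh T X))"
      unfolding triangle_iso.simps
      by (rule exI[of _ "Ident C X"], rule exI[of _ "Neg X X (Ident C X)"], rule exI[of _ "Ident C O'"])
        (use O assms(1) in \<open>auto simp: tri_simps iso_mor_Ident iso_mor_def
          intro!: bexI[of _ "Neg X X (Ident C X)"]\<close>)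
    from TR1_iso[OF TR1_id[OF assms(1) O(1)] _ this] show ?thesis
      using O assms(1) by (intro S_I[OF _ N_zero]) (auto simp: tri_simps)
  qed
  from S_Comp[OF this assms(3)] show ?thesis
    using assms S_Hom by (simp add: tri_simps)
qed

text \<open>
  Three rotations shift a triangle but change the sign of its first map, hence the detour through
  \<open>S_Neg\<close>.
\<close>

lemma S_sh:
  assumes "f \<in> S X Y"
  shows "sh_mor T X Y f \<in> S (sh T X) (sh T Y)"
proof -
  obtain Q g h where t: "(X, Y, Q, f, g, h) \<in> Tr" "Q \<in> N" using assms by (rule S_E)
  note p = triangle_parts[OF t(1)]
  have "Neg (sh T X) (sh T Y) (sh_mor T X Y f) \<in> S (sh T X) (sh T Y)"
    by (rule S_I[OF rotate[OF rotate2[OF t(1)]]]) (use t p N_sh in simp)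
  from S_Neg[OF _ _ this] show ?thesis using p by (simp add: tri_simps)
qed

text \<open>
  If \<open>q\<close> is the map from \<open>Y\<close> to the cone \<open>Q\<close> of \<open>s\<close>, take for \<open>p\<close> the fibre of \<open>q k : W \<rightarrow> Q\<close>. Its cone is
  \<open>Q\<close> itself, and \<open>q (k p) = 0\<close> says that \<open>k p\<close> lifts along \<open>s\<close>.
\<close>

lemma Ore_square:
  assumes "s \<in> S Z Y" "k \<in> Hom C W Y" "W \<in> Obj C"
  obtains P p l where "P \<in> Obj C" "p \<in> S P W" "l \<in> Hom C P Z"
    "Comp C P W Y k p = Comp C P Z Y s l"
proof -
  obtain Q q r where t: "(Z, Y, Q, s, q, r) \<in> Tr" "Q \<in> N" using assms(1) by (rule S_E)
  note o = triangle_parts[OF t(1)]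
  have qk: "Comp C W Y Q q k \<in> Hom C W Q" using o assms by (simp add: tri_simps)
  obtain P p h where tP: "(P, W, Q, p, Comp C W Y Q q k, h) \<in> Tr"
    by (rule ex_fibre[OF assms(3) o(3) qk])
  note o' = triangle_parts[OF tP]
  have kp: "Comp C P W Y k p \<in> Hom C P Y" using o o' assms by (simp add: tri_simps)
  have "Comp C P Y Q q (Comp C P W Y k p) = Zero C P Q"
    using triangle_comp_zero[OF tP] o o' assms by (simp add: Comp_assoc)
  from factor_through_fibre[OF t(1) o'(1) kp this] obtain l where
    "l \<in> Hom C P Z" "Comp C P W Y k p = Comp C P Z Y s l" by blast
  then show ?thesis using that o' S_I[OF tP t(2)] by blast
qed

text \<open>
  The difference \<open>k - k'\<close> factors as \<open>P \<rightarrow> F \<rightarrow> W\<close> through the fibre \<open>F\<close> of \<open>t\<close>, which lies in \<open>N\<close>. The fibre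
  of \<open>P \<rightarrow> F\<close> maps to \<open>P\<close> with cone \<open>F\<close> and kills the difference.
\<close>

lemma Ore_cancel:
  assumes t: "t \<in> S W Y" and k: "k \<in> Hom C P W" "k' \<in> Hom C P W" and P: "P \<in> Obj C"
    and eq: "Comp C P W Y t k = Comp C P W Y t k'"
  obtains P' d where "P' \<in> Obj C" "d \<in> S P' P" "Comp C P' P W k d = Comp C P' P W k' d"
proof -
  obtain Q q r where tQ: "(W, Y, Q, t, q, r) \<in> Tr" "Q \<in> N" using t by (rule S_E)
  note o = triangle_parts[OF tQ(1)]
  obtain F w h u where tF: "(F, W, Y, w, t, h) \<in> Tr" and u: "iso_mor C Q (sh T F) u"
    by (rule ex_fibre_of_cone[OF tQ(1)])
  note o' = triangle_parts[OF tF]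
  have F: "F \<in> N" using N_iso[OF tQ(2) _ u] N_sh o' sh_obj by blast
  define e where "e = Add C P W k (Neg P W k')"
  have e: "e \<in> Hom C P W" using k P o by (simp add: e_def tri_simps)
  have "Comp C P W Y t e = Zero C P Y"
    using k P o eq by (simp add: e_def tri_simps Comp_Add_right Add_Neg_right)
  from factor_through_fibre[OF tF P e this] obtain e' where
    e': "e' \<in> Hom C P F" "e = Comp C P F W w e'" by blast
  obtain P' d h' where tP: "(P', P, F, d, e', h') \<in> Tr" by (rule ex_fibre[OF P o'(1) e'(1)])
  note o'' = triangle_parts[OF tP]
  have "Comp C P' P W e d = Comp C P' F W w (Comp C P' P F e' d)"
    using e' o' o'' by (simp add: Comp_assoc)
  then have "Comp C P' P W e d = Zero C P' W"
    using triangle_comp_zero[OF tP] o' o'' by (simp add: tri_simps)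
  then have "Add C P' W (Comp C P' P W k d) (Neg P' W (Comp C P' P W k' d)) = Zero C P' W"
    using k o o'' P by (simp add: e_def tri_simps Comp_Add_left)
  then have "Comp C P' P W k d = Comp C P' P W k' d"
    by (rule Add_Neg_eq_Zero[rotated 4])
      (use k o o'' in \<open>simp_all add: e_def tri_simps Comp_Add_left\<close>)
  then show ?thesis using that o'' S_I[OF tP F] by blast
qed

text \<open>
  An Ore square over \<open>Y\<close> commutes over \<open>W\<close> after cancelling \<open>t\<close>. This variant lets \<open>b\<close> be treated as a
  denominator although only \<open>t b\<close>, and not \<open>b\<close> itself, is known to be one; equivalences of roofs
  provide just that.
\<close>

lemma Ore_pullback:
  assumes t: "t \<in> S W Y" and b: "b \<in> Hom C B W" "Comp C B W Y t b \<in> S B Y"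
    and k: "k \<in> Hom C Q W" and obj: "W \<in> Obj C" "Y \<in> Obj C" "B \<in> Obj C" "Q \<in> Obj C"
  obtains P c l where "P \<in> Obj C" "c \<in> S P Q" "l \<in> Hom C P B"
    "Comp C P B W b l = Comp C P Q W k c"
proof -
  note t' = S_Hom[OF t]
  obtain P p l where P: "P \<in> Obj C" "p \<in> S P Q" "l \<in> Hom C P B"
    and eq: "Comp C P Q Y (Comp C Q W Y t k) p = Comp C P B Y (Comp C B W Y t b) l"
    using Ore_square[OF b(2), of "Comp C Q W Y t k" Q] k obj t' Comp_closed by blast
  note p' = S_Hom[OF P(2)]
  have "Comp C P W Y t (Comp C P Q W k p) = Comp C P W Y t (Comp C P B W b l)"
    using eq k obj t' P p' b by (simp add: Comp_assoc)
  from Ore_cancel[OF t _ _ P(1) this] obtain P' d where P': "P' \<in> Obj C" "d \<in> S P' P"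
    and eq': "Comp C P' P W (Comp C P Q W k p) d = Comp C P' P W (Comp C P B W b l) d"
    using k obj P p' b by (metis Comp_closed)
  have "Comp C P' B W b (Comp C P' P B l d) = Comp C P' Q W k (Comp C P' P Q p d)"
    using eq' k obj P p' b P' S_Hom[OF P'(2)] by (simp add: Comp_assoc)
  moreover have "Comp C P' P Q p d \<in> S P' Q" using S_Comp P P' by blast
  moreover have "Comp C P' P B l d \<in> Hom C P' B" using P P' S_Hom obj by (simp add: tri_simps)
  ultimately show ?thesis using that P' by blast
qed

text \<open>
  Precomposition of a commutative square with \<open>e\<close>, in the bracketing in which rewriting with
  associativity leaves such composites.
\<close>

lemma extend_eq:
  assumes "Comp C X Y Z g f = Comp C X Y' Z g' f'" "W \<in> Obj C" "X \<in> Obj C" "Y \<in> Obj C"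
    "Y' \<in> Obj C" "Z \<in> Obj C" "e \<in> Hom C W X" "f \<in> Hom C X Y" "f' \<in> Hom C X Y'"
    "g \<in> Hom C Y Z" "g' \<in> Hom C Y' Z"
  shows "Comp C W Y Z g (Comp C W X Y f e) = Comp C W Y' Z g' (Comp C W X Y' f' e)"
  using assms by (simp add: Comp_assoc)

lemma roof_equiv_refl: "\<lbrakk>X \<in> Obj C; \<rho> \<in> roofs C T N X Y\<rbrakk> \<Longrightarrow> roof_equiv C T N X Y \<rho> \<rho>"
  by (auto simp: roofs_def tri_simps S_Hom intro!: bexI[of _ "fst \<rho>"] bexI[of _ "Ident C (fst \<rho>)"])

lemma roof_class_self: "\<lbrakk>X \<in> Obj C; \<rho> \<in> roofs C T N X Y\<rbrakk> \<Longrightarrow> \<rho> \<in> roof_class C T N X Y \<rho>"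
  unfolding roof_class_def by (simp add: roof_equiv_refl del: roof_equiv.simps)

lemma roof_equiv_sym: "roof_equiv C T N X Y \<rho> \<rho>' \<Longrightarrow> roof_equiv C T N X Y \<rho>' \<rho>"
  by (cases \<rho>; cases \<rho>') (simp, metis)

lemma roof_equiv_trans:
  assumes obj: "X \<in> Obj C" "Y \<in> Obj C"
    and \<rho>: "\<rho> \<in> roofs C T N X Y" "\<rho>' \<in> roofs C T N X Y" "\<rho>'' \<in> roofs C T N X Y"
    and eq: "roof_equiv C T N X Y \<rho> \<rho>'" "roof_equiv C T N X Y \<rho>' \<rho>''"
  shows "roof_equiv C T N X Y \<rho> \<rho>''"
proof -
  obtain Z s f Z' s' f' Z'' s'' f'' where
    roof: "\<rho> = (Z, s, f)" "\<rho>' = (Z', s', f')" "\<rho>'' = (Z'', s'', f'')"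
    by (cases \<rho>; cases \<rho>'; cases \<rho>'') blast
  have Z: "Z \<in> Obj C" "Z' \<in> Obj C" "Z'' \<in> Obj C"
    and s: "s \<in> S Z X" "s' \<in> S Z' X" "s'' \<in> S Z'' X"
    and f: "f \<in> Hom C Z Y" "f' \<in> Hom C Z' Y" "f'' \<in> Hom C Z'' Y"
    using \<rho> by (auto simp: roofs_def roof)
  note s' = s[THEN S_Hom]
  obtain W u v where W: "W \<in> Obj C" "u \<in> Hom C W Z" "v \<in> Hom C W Z'"
    "Comp C W Z X s u \<in> S W X"
    and su: "Comp C W Z X s u = Comp C W Z' X s' v"
    and fu: "Comp C W Z Y f u = Comp C W Z' Y f' v" using eq(1) by (auto simp: roof)
  obtain W' u' v' where W': "W' \<in> Obj C" "u' \<in> Hom C W' Z'" "v' \<in> Hom C W' Z''"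
    "Comp C W' Z' X s' u' \<in> S W' X"
    and su': "Comp C W' Z' X s' u' = Comp C W' Z'' X s'' v'"
    and fu': "Comp C W' Z' Y f' u' = Comp C W' Z'' Y f'' v'" using eq(2) by (auto simp: roof)
  have "Comp C W Z' X s' v \<in> S W X" using W(4) su by simp
  from Ore_pullback[OF s(2) W(3) this W'(2) Z(2) obj(1) W(1) W'(1)]
  obtain P c l where P: "P \<in> Obj C" "c \<in> S P W'" "l \<in> Hom C P W"
    and lc: "Comp C P W Z' v l = Comp C P W' Z' u' c" by blast
  note c = S_Hom[OF P(2)]
  note h = obj Z s' f W W' P c
  have 1: "Comp C P Z X s (Comp C P W Z u l) = Comp C P W' X (Comp C W' Z' X s' u') c"
    using extend_eq[OF su, of P l] h by (simp add: Comp_assoc[symmetric] lc)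
  have 2: "Comp C P Z X s (Comp C P W Z u l) = Comp C P Z'' X s'' (Comp C P W' Z'' v' c)"
    using 1 extend_eq[OF su', of P c] h by (simp add: Comp_assoc[symmetric])
  have 3: "Comp C P Z Y f (Comp C P W Z u l) = Comp C P Z'' Y f'' (Comp C P W' Z'' v' c)"
    using extend_eq[OF fu, of P l] extend_eq[OF fu', of P c] h by (simp add: lc)
  have "Comp C P Z X s (Comp C P W Z u l) \<in> S P X"
    unfolding 1 using S_Comp[OF P(2) W'(4)] .
  moreover have "Comp C P W Z u l \<in> Hom C P Z" "Comp C P W' Z'' v' c \<in> Hom C P Z''"
    using h by (simp_all add: tri_simps)
  ultimately show ?thesis using 2 3 P(1) unfolding roof roof_equiv.simps by blast
qed

lemma roof_class_eq:
  assumes "X \<in> Obj C" "Y \<in> Obj C" "\<rho> \<in> roofs C T N X Y" "\<rho>' \<in> roofs C T N X Y"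
    and "roof_equiv C T N X Y \<rho> \<rho>'"
  shows "roof_class C T N X Y \<rho> = roof_class C T N X Y \<rho>'"
  using assms roof_equiv_sym roof_equiv_trans unfolding roof_class_def by blast

lemma trivial_roof: "\<lbrakk>X \<in> Obj C; f \<in> Hom C X Y\<rbrakk> \<Longrightarrow> (X, Ident C X, f) \<in> roofs C T N X Y"
  by (simp add: roofs_def S_Ident)

text \<open>
  The image of \<open>f\<close> in the Verdier quotient.
\<close>

abbreviation V where "V X Y f \<equiv> roof_class C T N X Y (X, Ident C X, f)"

text \<open>
  In terms of fractions: \<open>(g0 t0\<inverse>)(t0 a') = g0 a'\<close>. The case \<open>t0 = id\<close> is functoriality of the quotient
  functor; the case in which \<open>t0 a'\<close> is a scalar clears denominators (\<open>L_clear_denominator\<close>).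

  The composite in the quotient is a union over all representatives and all Ore squares, and the work
  is to see that each of them gives the same class. Let \<open>A\<close> and \<open>B\<close> witness the equivalences of
  \<open>(Z, s, f)\<close> and \<open>(W, t, g)\<close> with the given roofs. Pulling \<open>P\<close> back successively to \<open>A\<close>, to \<open>B\<close>, and to
  where \<open>t0\<close> can be cancelled yields \<open>y : Q3 \<rightarrow> P\<close> over which both roofs agree.
\<close>

lemma verdier_Comp_numerator:
  assumes obj: "X \<in> Obj C" "Y \<in> Obj C" "V' \<in> Obj C" "W0 \<in> Obj C"
    and t0: "t0 \<in> S W0 Y" and g0: "g0 \<in> Hom C W0 V'" and a': "a' \<in> Hom C X W0"
  shows "Comp (verdier_category C T N) X Y V' (roof_class C T N Y V' (W0, t0, g0))
      (V X Y (Comp C X W0 Y t0 a')) = V X V' (Comp C X W0 V' g0 a')"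
    (is "Comp _ X Y V' ?\<beta> (V X Y ?a) = ?\<gamma>")
proof -
  note t0' = S_Hom[OF t0]
  have \<gamma>: "(X, Ident C X, Comp C X W0 V' g0 a') \<in> roofs C T N X V'"
    using obj g0 a' by (intro trivial_roof) (simp_all add: tri_simps)
  have main: "roof_class C T N X V' (P, Comp C P Z X s u, Comp C P W V' g v) = ?\<gamma>"
    if \<alpha>: "(Z, s, f) \<in> V X Y ?a" and \<beta>: "(W, t, g) \<in> ?\<beta>" and P: "P \<in> Obj C" "u \<in> S P Z" "v \<in> Hom C P W"
      and sq: "Comp C P Z Y f u = Comp C P W Y t v" for Z s f W t g P u v
  proof -
    note u' = S_Hom[OF P(2)]
    have Z: "Z \<in> Obj C" "s \<in> S Z X" "f \<in> Hom C Z Y" and W: "W \<in> Obj C" "t \<in> S W Y" "g \<in> Hom C W V'"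
      using \<alpha> \<beta> by (auto simp: roof_class_def roofs_def)
    note s' = S_Hom[OF Z(2)] and t' = S_Hom[OF W(2)]
    obtain A u1 v1 where A: "A \<in> Obj C" "u1 \<in> Hom C A X" "v1 \<in> Hom C A Z" "u1 \<in> S A X"
      and u1: "u1 = Comp C A Z X s v1" and au1: "Comp C A X Y ?a u1 = Comp C A Z Y f v1"
      using \<alpha> obj(1) by (auto simp: roof_class_def tri_simps)
    obtain B u2 v2 where B: "B \<in> Obj C" "u2 \<in> Hom C B W0" "v2 \<in> Hom C B W"
      "Comp C B W0 Y t0 u2 \<in> S B Y"
      and u2: "Comp C B W0 Y t0 u2 = Comp C B W Y t v2"
      and gu2: "Comp C B W0 V' g0 u2 = Comp C B W V' g v2"
      using \<beta> obj by (auto simp: roof_class_def tri_simps)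
    define m where "m = Comp C P Z X s u"
    have m: "m \<in> Hom C P X" using obj P Z s' u' by (simp add: m_def tri_simps)
    have mS: "m \<in> S P X" unfolding m_def using S_Comp P(2) Z(2) by blast
    have "Comp C A Z X s v1 \<in> S A X" using A(4) u1 by simp
    from Ore_pullback[OF Z(2) A(3) this u' Z(1) obj(1) A(1) P(1)]
    obtain Q1 \<pi> \<alpha>' where Q1: "Q1 \<in> Obj C" "\<pi> \<in> S Q1 P" "\<alpha>' \<in> Hom C Q1 A"
      and eq1: "Comp C Q1 A Z v1 \<alpha>' = Comp C Q1 P Z u \<pi>" by blast
    note \<pi>' = S_Hom[OF Q1(2)]
    have vpi: "Comp C Q1 P W v \<pi> \<in> Hom C Q1 W" using P Q1 W \<pi>' by (simp add: tri_simps)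
    have "Comp C B W Y t v2 \<in> S B Y" using B(4) u2 by simp
    from Ore_pullback[OF W(2) B(3) this vpi W(1) obj(2) B(1) Q1(1)]
    obtain Q2 \<gamma> \<beta>' where Q2: "Q2 \<in> Obj C" "\<gamma> \<in> S Q2 Q1" "\<beta>' \<in> Hom C Q2 B"
      and eq2: "Comp C Q2 B W v2 \<beta>' = Comp C Q2 Q1 W (Comp C Q1 P W v \<pi>) \<gamma>" by blast
    note \<gamma>' = S_Hom[OF Q2(2)]
    note h = obj t0' g0 a' P u' Z s' W t' A(1-3) B(1-3) Q1 \<pi>' Q2 \<gamma>' m
    \<comment> \<open>compare the numerator \<open>f\<close> with \<open>t0 a'\<close>\<close>
    have m\<pi>: "Comp C Q1 P X m \<pi> = Comp C Q1 A X u1 \<alpha>'"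
      unfolding m_def u1 using h eq1 by (simp add: Comp_assoc[symmetric])
    have tv: "Comp C Q1 W Y t (Comp C Q1 P W v \<pi>) = Comp C Q1 X Y ?a (Comp C Q1 P X m \<pi>)"
    proof -
      have "Comp C Q1 W Y t (Comp C Q1 P W v \<pi>) = Comp C Q1 Z Y f (Comp C Q1 P Z u \<pi>)"
        using extend_eq[OF sq, of Q1 \<pi>] h by simp
      also have "\<dots> = Comp C Q1 X Y ?a (Comp C Q1 A X u1 \<alpha>')"
        using extend_eq[OF au1, of Q1 \<alpha>'] h by (simp add: eq1 tri_simps)
      finally show ?thesis unfolding m\<pi> .
    qed
    \<comment> \<open>compare \<open>g\<close> with \<open>g0\<close>, which needs \<open>t0\<close> cancelled from the equation \<open>eq3\<close>\<close>
    define n where "n = Comp C Q2 P X m (Comp C Q2 Q1 P \<pi> \<gamma>)"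
    have n: "n \<in> Hom C Q2 X" using h by (simp add: n_def tri_simps)
    have "Comp C Q2 W0 Y t0 (Comp C Q2 B W0 u2 \<beta>') = Comp C Q2 W Y t (Comp C Q2 B W v2 \<beta>')"
      using extend_eq[OF u2, of Q2 \<beta>'] h by simp
    also have "\<dots> = Comp C Q2 Q1 Y (Comp C Q1 W Y t (Comp C Q1 P W v \<pi>)) \<gamma>"
      unfolding eq2 using h by (simp add: tri_simps Comp_assoc)
    also have "\<dots> = Comp C Q2 W0 Y t0 (Comp C Q2 X W0 a' n)"
      unfolding tv n_def using h by (simp add: tri_simps Comp_assoc)
    finally have eq3: "Comp C Q2 W0 Y t0 (Comp C Q2 B W0 u2 \<beta>') =
        Comp C Q2 W0 Y t0 (Comp C Q2 X W0 a' n)" .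
    have "Comp C Q2 B W0 u2 \<beta>' \<in> Hom C Q2 W0" "Comp C Q2 X W0 a' n \<in> Hom C Q2 W0"
      using h n by (simp_all add: tri_simps)
    from Ore_cancel[OF t0 this Q2(1) eq3] obtain Q3 \<epsilon> where Q3: "Q3 \<in> Obj C" "\<epsilon> \<in> S Q3 Q2"
      and eq4: "Comp C Q3 Q2 W0 (Comp C Q2 B W0 u2 \<beta>') \<epsilon> = Comp C Q3 Q2 W0 (Comp C Q2 X W0 a' n) \<epsilon>"
      by blast
    note \<epsilon>' = S_Hom[OF Q3(2)]
    define y where "y = Comp C Q3 Q2 P (Comp C Q2 Q1 P \<pi> \<gamma>) \<epsilon>"
    have yS: "y \<in> S Q3 P" unfolding y_def using S_Comp Q1 Q2 Q3 by blast
    note y = S_Hom[OF yS]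
    note h = h n Q3 \<epsilon>' y
    have my: "Comp C Q3 P X m y = Comp C Q3 Q2 X n \<epsilon>"
      unfolding y_def n_def using h by (simp add: tri_simps Comp_assoc)
    have vy: "Comp C Q3 P W v y = Comp C Q3 Q2 W (Comp C Q2 B W v2 \<beta>') \<epsilon>"
      unfolding y_def eq2 using h by (simp add: tri_simps Comp_assoc)
    have "Comp C Q3 P V' (Comp C P W V' g v) y = Comp C Q3 W V' g (Comp C Q3 P W v y)"
      using h W by (simp add: Comp_assoc)
    also have "\<dots> = Comp C Q3 Q2 V' (Comp C Q2 W V' g (Comp C Q2 B W v2 \<beta>')) \<epsilon>"
      unfolding vy using h W by (simp add: tri_simps Comp_assoc)
    also have "\<dots> = Comp C Q3 Q2 V' (Comp C Q2 W0 V' g0 (Comp C Q2 B W0 u2 \<beta>')) \<epsilon>"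
      using extend_eq[OF gu2, of Q2 \<beta>'] h W by simp
    also have "\<dots> = Comp C Q3 W0 V' g0 (Comp C Q3 Q2 W0 (Comp C Q2 B W0 u2 \<beta>') \<epsilon>)"
      using h by (simp add: tri_simps Comp_assoc)
    also have "\<dots> = Comp C Q3 X V' (Comp C X W0 V' g0 a') (Comp C Q3 Q2 X n \<epsilon>)"
      unfolding eq4 using h by (simp add: tri_simps Comp_assoc)
    finally have fin: "Comp C Q3 P V' (Comp C P W V' g v) y =
        Comp C Q3 X V' (Comp C X W0 V' g0 a') (Comp C Q3 P X m y)" unfolding my .
    have "roof_equiv C T N X V' (P, m, Comp C P W V' g v) (X, Ident C X, Comp C X W0 V' g0 a')"
      unfolding roof_equiv.simps
      by (rule bexI[of _ Q3], rule bexI[of _ y], rule bexI[of _ "Comp C Q3 P X m y"])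
        (use h S_Comp[OF yS mS] fin in \<open>simp_all add: tri_simps\<close>)
    moreover have "(P, m, Comp C P W V' g v) \<in> roofs C T N X V'"
      using mS h W by (simp add: roofs_def tri_simps)
    ultimately show ?thesis using roof_class_eq[OF obj(1,3)] \<gamma> unfolding m_def by blast
  qed
  have a: "?a \<in> Hom C X Y" using obj t0' a' by (simp add: tri_simps)
  let ?A = "{roof_class C T N X V' (P, Comp C P Z X s u, Comp C P W V' g v) | Z s f W t g P u v.
          (Z, s, f) \<in> V X Y ?a \<and> (W, t, g) \<in> ?\<beta> \<and> P \<in> Obj C \<and>
          u \<in> S P Z \<and> v \<in> Hom C P W \<and> Comp C P Z Y f u = Comp C P W Y t v}"
  have "?A \<subseteq> {?\<gamma>}" by (rule subsetI) (auto dest: main)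
  moreover have "roof_class C T N X V'
      (X, Comp C X X X (Ident C X) (Ident C X), Comp C X W0 V' g0 a') \<in> ?A"
    unfolding mem_Collect_eq
  proof (intro exI conjI)
    show "roof_class C T N X V' (X, Comp C X X X (Ident C X) (Ident C X), Comp C X W0 V' g0 a') =
      roof_class C T N X V' (X, Comp C X X X (Ident C X) (Ident C X), Comp C X W0 V' g0 a')" ..
    show "(X, Ident C X, ?a) \<in> V X Y ?a"
      by (rule roof_class_self[OF obj(1) trivial_roof[OF obj(1) a]])
    have "(W0, t0, g0) \<in> roofs C T N Y V'" using obj t0 g0 by (simp add: roofs_def)
    then show "(W0, t0, g0) \<in> ?\<beta>" by (rule roof_class_self[OF obj(2)])
    show "Comp C X X Y ?a (Ident C X) = Comp C X W0 Y t0 a'" using obj a by (simp add: tri_simps)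
  qed (use obj a' in \<open>simp_all add: S_Ident\<close>)
  ultimately have "\<Union>?A = ?\<gamma>" by (rule Union_eq_if_subset_singleton)
  then show ?thesis unfolding verdier_category_def by simp
qed

lemma verdier_functor_Comp:
  assumes "X \<in> Obj C" "Y \<in> Obj C" "Z \<in> Obj C" "f \<in> Hom C X Y" "g \<in> Hom C Y Z"
  shows "Comp (verdier_category C T N) X Y Z (V Y Z g) (V X Y f) = V X Z (Comp C X Y Z g f)"
  using verdier_Comp_numerator[OF assms(1-3) assms(2) S_Ident[OF assms(2)] assms(5,4)] assms
  by (simp add: tri_simps)

lemma verdier_functor_sh:
  assumes obj: "X \<in> Obj C" "Y \<in> Obj C" and f: "f \<in> Hom C X Y"
  shows "sh_mor (verdier_suspension C T N) X Y (V X Y f) = V (sh T X) (sh T Y) (sh_mor T X Y f)"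
proof -
  have tr: "(sh T X, Ident C (sh T X), sh_mor T X Y f) \<in> roofs C T N (sh T X) (sh T Y)"
    using assms by (intro trivial_roof) (simp_all add: tri_simps)
  have "roof_class C T N (sh T X) (sh T Y) (sh T Z, sh_mor T Z X s, sh_mor T Z Y g) =
      V (sh T X) (sh T Y) (sh_mor T X Y f)" if \<alpha>: "(Z, s, g) \<in> V X Y f" for Z s g
  proof (rule sym, rule roof_class_eq[OF _ _ tr])
    have Z: "Z \<in> Obj C" "s \<in> S Z X" "g \<in> Hom C Z Y" using \<alpha> by (auto simp: roof_class_def roofs_def)
    note s' = S_Hom[OF Z(2)]
    obtain A u v where A: "A \<in> Obj C" "u \<in> Hom C A X" "v \<in> Hom C A Z" "u \<in> S A X"
      and u: "u = Comp C A Z X s v" and fu: "Comp C A X Y f u = Comp C A Z Y g v"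
      using \<alpha> obj(1) by (auto simp: roof_class_def tri_simps)
    show "(sh T Z, sh_mor T Z X s, sh_mor T Z Y g) \<in> roofs C T N (sh T X) (sh T Y)"
      using Z obj S_sh by (simp add: roofs_def tri_simps)
    show "roof_equiv C T N (sh T X) (sh T Y) (sh T X, Ident C (sh T X), sh_mor T X Y f)
        (sh T Z, sh_mor T Z X s, sh_mor T Z Y g)"
      unfolding roof_equiv.simps
      by (rule bexI[of _ "sh T A"], rule bexI[of _ "sh_mor T A X u"], rule bexI[of _ "sh_mor T A Z v"])
        (use obj f Z s' A u fu S_sh[OF A(4)] in \<open>simp_all add: tri_simps sh_Comp[symmetric]\<close>)
  qed (use obj in \<open>simp_all add: tri_simps\<close>)
  moreover have "(X, Ident C X, f) \<in> V X Y f"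
    by (rule roof_class_self[OF obj(1) trivial_roof[OF obj(1) f]])
  ultimately show ?thesis unfolding verdier_suspension_def by fastforce
qed

lemma verdier_functor_Hom:
  "\<lbrakk>X \<in> Obj C; f \<in> Hom C X Y\<rbrakk> \<Longrightarrow> V X Y f \<in> Hom (verdier_category C T N) X Y"
  unfolding verdier_category_def using trivial_roof by simp

text \<open>
  Distinguished triangles of the quotient are by definition those isomorphic to images of distinguished
  triangles. For an image itself the isomorphism is the identity; that it commutes with the three maps
  follows from functoriality.
\<close>

lemma verdier_functor_exact:
  assumes "t \<in> Tr"
  shows "map_triangle T (verdier_functor C T N) t \<in> triangles (verdier_triangulation C T N)"
proof -
  obtain X Y Z f g h where [simp]: "t = (X, Y, Z, f, g, h)" by (cases t) blast
  note p = triangle_parts[OF assms[simplified]]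
  let ?Q = "verdier_category C T N" and ?T = "verdier_suspension C T N"
  have sh: "sh ?T = sh T" by (simp add: verdier_suspension_def)
  have id: "Ident ?Q A = V A A (Ident C A)" for A by (simp add: verdier_category_def)
  have ob: "Obj ?Q = Obj C" by (simp add: verdier_category_def)
  have iso: "iso_mor ?Q A A (V A A (Ident C A))" if "A \<in> Obj C" for A
    using that unfolding iso_mor_def id
    by (intro conjI bexI[of _ "V A A (Ident C A)"])
      (simp_all add: verdier_functor_Hom verdier_functor_Comp tri_simps)
  have tri: "is_triangle ?Q ?T (X, Y, Z, V X Y f, V Y Z g, V Z (sh T X) h)"
    using p by (simp add: ob sh verdier_functor_Hom)
  have "triangle_mor ?Q ?T (X, Y, Z, V X Y f, V Y Z g, V Z (sh T X) h)
      (X, Y, Z, V X Y f, V Y Z g, V Z (sh T X) h)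
      (V X X (Ident C X), V Y Y (Ident C Y), V Z Z (Ident C Z))"
    using p by (simp add: sh verdier_functor_Hom verdier_functor_Comp verdier_functor_sh tri_simps)
  then have "triangle_iso ?Q ?T (X, Y, Z, V X Y f, V Y Z g, V Z (sh T X) h)
      (X, Y, Z, V X Y f, V Y Z g, V Z (sh T X) h)"
    unfolding triangle_iso.simps using iso p by blast
  moreover have map: "map_triangle T (verdier_functor C T N) t =
      (X, Y, Z, V X Y f, V Y Z g, V Z (sh T X) h)"
    by (simp add: verdier_functor_def)
  ultimately have "\<exists>t'\<in>Tr. triangle_iso ?Q ?T (map_triangle T (verdier_functor C T N) t')
      (X, Y, Z, V X Y f, V Y Z g, V Z (sh T X) h)"
    by (intro bexI[OF _ assms]) (simp only: map)
  with tri show ?thesis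
    unfolding map by (simp add: verdier_triangulation_def del: triangle_iso.simps is_triangle.simps)
qed

lemma verdier_functor_eqD:
  assumes obj: "X \<in> Obj C" "Y \<in> Obj C" and f: "f \<in> Hom C X Y" "g \<in> Hom C X Y" and eq: "V X Y f = V X Y g"
  obtains W w where "W \<in> Obj C" "w \<in> S W X" "Comp C W X Y f w = Comp C W X Y g w"
proof -
  have "(X, Ident C X, g) \<in> V X Y f"
    unfolding eq by (rule roof_class_self[OF obj(1) trivial_roof[OF obj(1) f(2)]])
  then obtain W u v where "W \<in> Obj C" "u \<in> Hom C W X" "v \<in> Hom C W X"
    "Comp C W X X (Ident C X) u \<in> S W X"
    "Comp C W X X (Ident C X) u = Comp C W X X (Ident C X) v" "Comp C W X Y f u = Comp C W X Y g v"
    by (auto simp: roof_class_def)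
  then show ?thesis using that obj by (auto simp: tri_simps)
qed

end

section \<open>Scalars factoring through a class of objects\<close>

lemma (in is_linear_category) Add_Neg_Add_Neg:
  assumes "X \<in> Obj C" "Y \<in> Obj C" "f \<in> Hom C X Y" "g \<in> Hom C X Y"
  shows "Add C X Y f (Neg X Y (Add C X Y f (Neg X Y g))) = g"
proof -
  interpret M: Module.module R "hom_module C X Y" by (rule hom_module[OF assms(1,2)])
  show ?thesis
    using M.minus_add[of f "Neg X Y g"] M.minus_minus[of g] M.r_neg2[of f g] M.r_neg1[of f g] M.a_inv_closed[of g] assms(3,4)
    by (simp add: hom_module_fields)
qed

definition scalar_factors ::
  "('o, 'm, 'r, 'x) linear_category_scheme \<Rightarrow> 'o set \<Rightarrow> 'o \<Rightarrow> 'r \<Rightarrow> bool" where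
  "scalar_factors C E X r \<longleftrightarrow>
     (\<exists>e\<in>E. \<exists>i\<in>Hom C X e. \<exists>j\<in>Hom C e X. Comp C X e X j i = Scale C X X r (Ident C X))"

lemma scalar_factorsI:
  "\<lbrakk>e \<in> E; i \<in> Hom C X e; j \<in> Hom C e X; Comp C X e X j i = Scale C X X r (Ident C X)\<rbrakk>
    \<Longrightarrow> scalar_factors C E X r"
  unfolding scalar_factors_def by blast

lemma retractI:
  "\<lbrakk>X \<in> Obj C; Y \<in> Obj C; i \<in> Hom C X Y; r \<in> Hom C Y X; Comp C X Y X r i = Ident C X\<rbrakk>
    \<Longrightarrow> retract C X Y"
  unfolding retract_def by blast

context is_linear_triangulated_category
begin

text \<open>
  If \<open>\<phi> = c + n\<close> and \<open>n\<^sup>2 = 0\<close> then \<open>c\<^sup>2 = c\<^sup>2 - n\<^sup>2 = \<phi> (c - n)\<close>.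
\<close>

lemma scalar_square_factors:
  assumes X: "X \<in> Obj C" and \<phi>: "\<phi> \<in> Hom C X X" and c: "c \<in> carrier R"
    and n: "n = Add C X X \<phi> (Neg X X (Scale C X X c (Ident C X)))"
    and nn: "Comp C X X X n n = Zero C X X"
  obtains \<psi> where "\<psi> \<in> Hom C X X" "Comp C X X X \<phi> \<psi> = Scale C X X (c \<otimes>\<^bsub>R\<^esub> c) (Ident C X)"
proof -
  let ?c = "Scale C X X c (Ident C X)"
  have nX: "n \<in> Hom C X X" using assms by (simp add: n tri_simps)
  have "Zero C X X = Add C X X (Comp C X X X \<phi> n) (Neg X X (Scale C X X c n))"
    unfolding nn[symmetric] by (subst n) (use X \<phi> c nX in \<open>simp add: tri_simps Comp_Add_left\<close>)
  from this[symmetric] have "Comp C X X X \<phi> n = Scale C X X c n"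
    by (rule Add_Neg_eq_Zero[OF X X, rotated 2]) (use X \<phi> c nX in \<open>simp_all add: tri_simps\<close>)
  also have "\<dots> = Add C X X (Scale C X X c \<phi>) (Neg X X (Scale C X X (c \<otimes>\<^bsub>R\<^esub> c) (Ident C X)))"
    using X \<phi> c by (simp add: n tri_simps Scale_add_right Neg_Scale)
  finally have \<phi>n: "Comp C X X X \<phi> n = \<dots>" .
  have "Comp C X X X \<phi> (Add C X X ?c (Neg X X n)) = Scale C X X (c \<otimes>\<^bsub>R\<^esub> c) (Ident C X)"
    using X \<phi> c nX by (simp add: tri_simps Comp_Add_right \<phi>n Add_Neg_Add_Neg)
  then show ?thesis using that[of "Add C X X ?c (Neg X X n)"] X c nX by (simp add: tri_simps)
qed

text \<open>
  Write \<open>r = a' a\<close> on \<open>A\<close> and \<open>s = b' b\<close> on \<open>B\<close>, through objects \<open>e1\<close> and \<open>e2\<close> of \<open>E\<close>, and let \<open>X1 \<in> E\<close> be the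
  extension of \<open>e2\<close> by \<open>e1\<close> with class \<open>h' = a[1] h b'\<close>. Then \<open>(s a, b)\<close> and \<open>(a', r b')\<close> are
  compatible with the connecting maps \<open>h\<close> and \<open>h'\<close>, hence extend to \<open>x1 : X \<rightarrow> X1\<close> and \<open>x2 : X1 \<rightarrow> X\<close>. The
  composite \<open>\<phi> = x2 x1\<close> acts as \<open>r s\<close> on both \<open>A\<close> and \<open>B\<close>. So \<open>n = \<phi> - r s\<close> satisfies \<open>n f = 0\<close> and
  \<open>g n = 0\<close>; the first equation gives \<open>n = k g\<close>, and then \<open>n\<^sup>2 = k g n = 0\<close>.
\<close>

lemma scalar_factors_extension:
  assumes E: "extension_closed C T E" "E \<subseteq> Obj C" and t: "(A, X, B, f, g, h) \<in> Tr"
    and r: "r \<in> carrier R" "scalar_factors C E A r"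
    and s: "s \<in> carrier R" "scalar_factors C E B s"
  shows "scalar_factors C E X ((r \<otimes>\<^bsub>R\<^esub> s) \<otimes>\<^bsub>R\<^esub> (r \<otimes>\<^bsub>R\<^esub> s))"
proof -
  note p = triangle_parts[OF t]
  obtain e1 a a' where 1: "e1 \<in> E" "a \<in> Hom C A e1" "a' \<in> Hom C e1 A"
    and a: "Comp C A e1 A a' a = Scale C A A r (Ident C A)" using r(2) unfolding scalar_factors_def by blast
  obtain e2 b b' where 2: "e2 \<in> E" "b \<in> Hom C B e2" "b' \<in> Hom C e2 B"
    and b: "Comp C B e2 B b' b = Scale C B B s (Ident C B)" using s(2) unfolding scalar_factors_def by blast
  have e: "e1 \<in> Obj C" "e2 \<in> Obj C" using E 1 2 by auto
  define h' where "h' = Comp C e2 (sh T A) (sh T e1) (sh_mor T A e1 a) (Comp C e2 B (sh T A) h b')"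
  have h': "h' \<in> Hom C e2 (sh T e1)" using p e 1 2 by (simp add: h'_def tri_simps)
  obtain X1 f1 g1 where t1: "(e1, X1, e2, f1, g1, h') \<in> Tr" by (rule ex_extension[OF e h'])
  note p1 = triangle_parts[OF t1]
  have X1: "X1 \<in> E" using E(1) t1 1(1) 2(1) unfolding extension_closed_def by blast
  note h = p p1 1(2,3) 2(2,3) e r(1) s(1)
  have "Comp C B e2 (sh T e1) h' b =
      Comp C B (sh T A) (sh T e1) (sh_mor T A e1 a) (Comp C B B (sh T A) h (Comp C B e2 B b' b))"
    unfolding h'_def using h by (simp add: tri_simps Comp_assoc)
  then have sq1: "Comp C B (sh T A) (sh T e1) (sh_mor T A e1 (Scale C A e1 s a)) h = Comp C B e2 (sh T e1) h' b"
    unfolding b using h by (simp add: tri_simps shift_Scale)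
  obtain x1 where x1: "x1 \<in> Hom C X X1" "Comp C A X X1 x1 f = Comp C A e1 X1 f1 (Scale C A e1 s a)"
    "Comp C X X1 e2 g1 x1 = Comp C X B e2 b g"
    by (rule ex_middle_morphism[OF t t1 _ 2(2) sq1]) (use h in \<open>simp_all add: tri_simps\<close>)
  have "Comp C e2 (sh T e1) (sh T A) (sh_mor T e1 A a') h' =
      Comp C e2 (sh T A) (sh T A) (sh_mor T A A (Comp C A e1 A a' a)) (Comp C e2 B (sh T A) h b')"
    unfolding h'_def using h by (simp add: tri_simps Comp_assoc sh_Comp)
  then have sq2: "Comp C e2 (sh T e1) (sh T A) (sh_mor T e1 A a') h' = Comp C e2 B (sh T A) h (Scale C e2 B r b')"
    unfolding a using h by (simp add: tri_simps shift_Scale)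
  obtain x2 where x2: "x2 \<in> Hom C X1 X" "Comp C e1 X1 X x2 f1 = Comp C e1 A X f a'"
    "Comp C X1 X B g x2 = Comp C X1 e2 B (Scale C e2 B r b') g1"
    by (rule ex_middle_morphism[OF t1 t 1(3) _ sq2]) (use h in \<open>simp_all add: tri_simps\<close>)
  define c where "c = r \<otimes>\<^bsub>R\<^esub> s"
  define \<phi> where "\<phi> = Comp C X X1 X x2 x1"
  define n where "n = Add C X X \<phi> (Neg X X (Scale C X X c (Ident C X)))"
  have c: "c \<in> carrier R" using h by (simp add: c_def)
  have \<phi>: "\<phi> \<in> Hom C X X" using h x1 x2 by (simp add: \<phi>_def tri_simps)
  have n: "n \<in> Hom C X X" using h \<phi> c by (simp add: n_def tri_simps)
  \<comment> \<open>\<open>\<phi> f = c f\<close>, so that \<open>n\<close> vanishes on \<open>A\<close>\<close>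
  have "Comp C A X X \<phi> f = Comp C A X1 X x2 (Comp C A e1 X1 f1 (Scale C A e1 s a))"
    unfolding \<phi>_def x1(2)[symmetric] using h x1(1) x2(1) by (simp add: tri_simps Comp_assoc)
  also have "\<dots> = Comp C A e1 X (Comp C e1 X1 X x2 f1) (Scale C A e1 s a)"
    using h x2(1) by (simp add: tri_simps Comp_assoc)
  also have "\<dots> = Scale C A X s (Comp C A A X f (Comp C A e1 A a' a))"
    unfolding x2(2) using h by (simp add: tri_simps Comp_assoc)
  also have "\<dots> = Scale C A X c f"
    unfolding a c_def using h by (simp add: tri_simps scalars.m_comm)
  finally have "Comp C A X X n f = Zero C A X"
    unfolding n_def using h \<phi> c by (simp add: tri_simps Comp_Add_left Add_Neg_right)
  from factor_through_cone[OF t p(2) n this] obtain k where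
    k: "k \<in> Hom C B X" "n = Comp C X B X k g" by blast
  \<comment> \<open>\<open>g \<phi> = c g\<close>, so that \<open>n\<close> vanishes after projection to \<open>B\<close>\<close>
  have "Comp C X X B g \<phi> = Comp C X X1 B (Comp C X1 e2 B (Scale C e2 B r b') g1) x1"
    unfolding \<phi>_def x2(3)[symmetric] using h x1(1) x2(1) by (simp add: tri_simps Comp_assoc)
  also have "\<dots> = Comp C X e2 B (Scale C e2 B r b') (Comp C X X1 e2 g1 x1)"
    using h x1(1) by (simp add: tri_simps Comp_assoc)
  also have "\<dots> = Scale C X B r (Comp C X B B (Comp C B e2 B b' b) g)"
    unfolding x1(3) using h by (simp add: tri_simps Comp_assoc)
  also have "\<dots> = Scale C X B c g"
    unfolding b c_def using h by (simp add: tri_simps)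
  finally have gn: "Comp C X X B g n = Zero C X B"
    unfolding n_def using h \<phi> c by (simp add: tri_simps Comp_Add_right Add_Neg_right)
  have "Comp C X X X n n = Comp C X B X k (Comp C X X B g n)"
    using Comp_assoc[of X X B X n g k] k h n by simp
  then have "Comp C X X X n n = Zero C X X" using gn h k by (simp add: tri_simps)
  from scalar_square_factors[OF p(2) \<phi> c n_def this] obtain \<psi> where
    \<psi>: "\<psi> \<in> Hom C X X" "Comp C X X X \<phi> \<psi> = Scale C X X (c \<otimes>\<^bsub>R\<^esub> c) (Ident C X)" by blast
  have "Comp C X X1 X x2 (Comp C X X X1 x1 \<psi>) = Comp C X X X \<phi> \<psi>"
    unfolding \<phi>_def using h x1 x2 \<psi>(1) by (simp add: Comp_assoc)
  with \<psi>(2) show ?thesis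
    unfolding c_def[symmetric] using h x1 x2 \<psi>(1)
    by (intro scalar_factorsI[OF X1, where i = "Comp C X X X1 x1 \<psi>" and j = x2]) (simp_all add: tri_simps)
qed

text \<open>
  The cone \<open>W\<close> of the inclusion \<open>i : X \<rightarrow> P\<close> ought to be \<open>Y\<close>. For the present purpose it is enough that
  \<open>W\<close> is a retract of \<open>Y\<close>: the projection \<open>q\<close> induces \<open>l : W \<rightarrow> Y\<close>, and \<open>g j l\<close> differs from the
  identity by a map through \<open>h : W \<rightarrow> X[1]\<close>, which vanishes because \<open>i[1] h = 0\<close> and \<open>i\<close> is split.
\<close>

lemma biproduct_in_envelope:
  assumes E: "extension_closed C T E" "Karoubi_closed C E" "E \<subseteq> Obj C"
    and XY: "X \<in> E" "Y \<in> E" and P: "biproduct C X Y P"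
  shows "P \<in> E"
proof -
  obtain i j p q where P': "P \<in> Obj C" and ij: "i \<in> Hom C X P" "j \<in> Hom C Y P" "p \<in> Hom C P X" "q \<in> Hom C P Y"
    and pi: "Comp C X P X p i = Ident C X" and qj: "Comp C Y P Y q j = Ident C Y"
    and qi: "Comp C X P Y q i = Zero C X Y"
    and sum: "Add C P P (Comp C P X P i p) (Comp C P Y P j q) = Ident C P"
    using P unfolding biproduct_def by blast
  have obj: "X \<in> Obj C" "Y \<in> Obj C" using E XY by auto
  obtain W g h where t: "(X, P, W, i, g, h) \<in> Tr" using TR1_cone[OF obj(1) P' ij(1)] by blast
  note o = triangle_parts[OF t]
  obtain l where l: "l \<in> Hom C W Y" "q = Comp C P W Y l g"
    by (rule factor_through_cone[OF t obj(2) ij(4) qi])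
  define w where "w = Comp C W Y W (Comp C Y P W g j) l"
  define d where "d = Add C W W (Ident C W) (Neg W W w)"
  have w: "w \<in> Hom C W W" and d: "d \<in> Hom C W W"
    using o obj ij l by (simp_all add: w_def d_def tri_simps)
  have gi: "Comp C X P W g i = Zero C X W" by (rule triangle_comp_zero[OF t])
  have "g = Comp C P P W g (Add C P P (Comp C P X P i p) (Comp C P Y P j q))"
    using sum o by (simp add: tri_simps)
  also have "\<dots> = Comp C P Y W (Comp C Y P W g j) q"
    using o obj ij gi by (simp add: tri_simps Comp_Add_right Comp_assoc)
  also have "\<dots> = Comp C P W W w g"
    unfolding l(2) w_def using o obj ij l(1) by (simp add: tri_simps Comp_assoc)
  \<comment> \<open>so \<open>w = g j l\<close> agrees with the identity on the image of \<open>g\<close>\<close>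
  finally have "Comp C P W W w g = g" ..
  then have "Comp C P W W d g = Zero C P W"
    unfolding d_def using o w by (simp add: tri_simps Comp_Add_left Add_Neg_right)
  from factor_through_cone[OF rotate[OF t] o(3) d this] obtain m where
    m: "m \<in> Hom C (sh T X) W" "d = Comp C W (sh T X) W m h" by blast
  \<comment> \<open>\<open>h = 0\<close>, as \<open>i[1]\<close> is split by \<open>p[1]\<close>\<close>
  have "Neg W (sh T P) (Comp C W (sh T X) (sh T P) (sh_mor T X P i) h) = Zero C W (sh T P)"
    using triangle_comp_zero[OF rotate[OF rotate[OF t]]] o by (simp add: tri_simps)
  then have ih: "Comp C W (sh T X) (sh T P) (sh_mor T X P i) h = Zero C W (sh T P)"
    by (metis Neg_Neg Neg_Zero o sh_obj sh_closed Comp_closed)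
  have "h = Comp C W (sh T X) (sh T X) (sh_mor T X X (Comp C X P X p i)) h"
    unfolding pi using o by (simp add: tri_simps)
  also have "\<dots> = Comp C W (sh T P) (sh T X) (sh_mor T P X p) (Comp C W (sh T X) (sh T P) (sh_mor T X P i) h)"
    using o ij by (simp add: tri_simps sh_Comp Comp_assoc)
  also have "\<dots> = Zero C W (sh T X)" unfolding ih using o ij by (simp add: tri_simps)
  finally have "d = Zero C W W" using m o by (simp add: tri_simps)
  then have "Ident C W = w" unfolding d_def by (rule Add_Neg_eq_Zero[rotated 4]) (use o w in \<open>simp_all add: tri_simps\<close>)
  then have "retract C W Y"
    by (intro retractI[of _ _ _ l "Comp C Y P W g j"]) (use o obj ij l in \<open>simp_all add: w_def tri_simps\<close>)
  then have "W \<in> E" using E(2) XY(2) unfolding Karoubi_closed_def by blast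
  then show ?thesis using E(1) XY(1) t unfolding extension_closed_def by blast
qed

lemma scalar_factors_ideal:
  assumes E: "extension_closed C T E" "Karoubi_closed C E" "E \<subseteq> Obj C" and Y: "Y \<in> Obj C"
  shows "ideal {r \<in> carrier R. scalar_factors C E Y r} R" (is "ideal ?I R")
proof -
  have mult: "x \<otimes>\<^bsub>R\<^esub> r \<in> ?I" if r: "r \<in> ?I" and x: "x \<in> carrier R" for r x
  proof -
    obtain e i j where e: "e \<in> E" "i \<in> Hom C Y e" "j \<in> Hom C e Y"
      and ji: "Comp C Y e Y j i = Scale C Y Y r (Ident C Y)"
      using r unfolding scalar_factors_def by blast
    have "e \<in> Obj C" using e E by blast
    then have "Comp C Y e Y j (Scale C Y e x i) = Scale C Y Y (x \<otimes>\<^bsub>R\<^esub> r) (Ident C Y)"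
      using e x r Y ji by (simp add: tri_simps)
    moreover have "Scale C Y e x i \<in> Hom C Y e" using e x Y \<open>e \<in> Obj C\<close> by (simp add: tri_simps)
    ultimately show ?thesis using e x r unfolding scalar_factors_def by blast
  qed
  have zero: "\<zero>\<^bsub>R\<^esub> \<in> ?I"
  proof -
    obtain O' where O: "zero_object C O'" "O' \<in> Obj C" by (rule ex_zero)
    then have "O' \<in> E" using E unfolding extension_closed_def by blast
    then have "scalar_factors C E Y \<zero>\<^bsub>R\<^esub>"
      by (rule scalar_factorsI[of _ _ "Zero C Y O'" _ _ "Zero C O' Y"])
        (use O Y Scale_zero_left[of Y Y "Ident C Y"] in \<open>simp_all add: tri_simps\<close>)
    then show ?thesis by simp
  qed
  have add: "r \<oplus>\<^bsub>R\<^esub> s \<in> ?I" if r: "r \<in> ?I" and s: "s \<in> ?I" for r s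
  proof -
    obtain e1 a a' where 1: "e1 \<in> E" "a \<in> Hom C Y e1" "a' \<in> Hom C e1 Y"
      and a: "Comp C Y e1 Y a' a = Scale C Y Y r (Ident C Y)" using r unfolding scalar_factors_def by blast
    obtain e2 b b' where 2: "e2 \<in> E" "b \<in> Hom C Y e2" "b' \<in> Hom C e2 Y"
      and b: "Comp C Y e2 Y b' b = Scale C Y Y s (Ident C Y)" using s unfolding scalar_factors_def by blast
    have e: "e1 \<in> Obj C" "e2 \<in> Obj C" using E 1 2 by auto
    obtain P where P: "biproduct C e1 e2 P" using ex_biproduct[OF e] by blast
    then have PE: "P \<in> E" using biproduct_in_envelope E 1 2 by blast
    obtain i j p q where P': "P \<in> Obj C" and ij: "i \<in> Hom C e1 P" "j \<in> Hom C e2 P" "p \<in> Hom C P e1" "q \<in> Hom C P e2"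
      and pi: "Comp C e1 P e1 p i = Ident C e1" and qj: "Comp C e2 P e2 q j = Ident C e2"
      and pj: "Comp C e2 P e1 p j = Zero C e2 e1" and qi: "Comp C e1 P e2 q i = Zero C e1 e2"
      using P unfolding biproduct_def by blast
    note h = 1(2,3) 2(2,3) e P' ij Y
    define x where "x = Add C Y P (Comp C Y e1 P i a) (Comp C Y e2 P j b)"
    have x: "x \<in> Hom C Y P" using h by (simp add: x_def tri_simps)
    have px: "Comp C Y P e1 p x = a"
      unfolding x_def using h by (simp add: tri_simps Comp_Add_right Comp_assoc pi pj)
    have qx: "Comp C Y P e2 q x = b"
      unfolding x_def using h by (simp add: tri_simps Comp_Add_right Comp_assoc qi qj)
    have "Comp C Y P Y (Add C P Y (Comp C P e1 Y a' p) (Comp C P e2 Y b' q)) x =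
        Add C Y Y (Comp C Y e1 Y a' (Comp C Y P e1 p x)) (Comp C Y e2 Y b' (Comp C Y P e2 q x))"
      using h x by (simp add: tri_simps Comp_Add_left Comp_assoc)
    also have "\<dots> = Scale C Y Y (r \<oplus>\<^bsub>R\<^esub> s) (Ident C Y)"
      unfolding px qx a b using r s Y by (simp add: tri_simps Scale_add_left)
    finally have "Comp C Y P Y (Add C P Y (Comp C P e1 Y a' p) (Comp C P e2 Y b' q)) x = \<dots>" .
    moreover have "Add C P Y (Comp C P e1 Y a' p) (Comp C P e2 Y b' q) \<in> Hom C P Y"
      using h by (simp add: tri_simps)
    ultimately show ?thesis using x PE r s unfolding scalar_factors_def by blast
  qed
  have neg: "\<ominus>\<^bsub>R\<^esub> r \<in> ?I" if "r \<in> ?I" for r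
    using mult[OF that, of "\<ominus>\<^bsub>R\<^esub> \<one>\<^bsub>R\<^esub>"] that by (simp add: scalars.l_minus)
  show ?thesis
  proof (rule idealI)
    show "ring R" by (rule scalars.ring_axioms)
    show "subgroup ?I (add_monoid R)"
      by (rule scalars.add.subgroupI) (use zero add neg in \<open>auto simp: a_inv_def\<close>)
    fix r x assume "r \<in> ?I" "x \<in> carrier R"
    then show "x \<otimes>\<^bsub>R\<^esub> r \<in> ?I" by (rule mult)
    with \<open>r \<in> ?I\<close> \<open>x \<in> carrier R\<close> show "r \<otimes>\<^bsub>R\<^esub> x \<in> ?I" by (simp add: scalars.m_comm)
  qed
qed

lemma scalar_factors_oneD:
  assumes "Karoubi_closed C E" "E \<subseteq> Obj C" "Y \<in> Obj C" "scalar_factors C E Y \<one>\<^bsub>R\<^esub>"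
  shows "Y \<in> E"
proof -
  obtain e i j where e: "e \<in> E" "i \<in> Hom C Y e" "j \<in> Hom C e Y"
    and "Comp C Y e Y j i = Scale C Y Y \<one>\<^bsub>R\<^esub> (Ident C Y)"
    using assms(4) unfolding scalar_factors_def by blast
  then have "Comp C Y e Y j i = Ident C Y" using assms(3) by (simp add: tri_simps)
  then have "retract C Y e" using e assms(2,3) by (intro retractI) auto
  then show ?thesis using e(1) assms(1) unfolding Karoubi_closed_def by blast
qed

end

section \<open>Objects annihilated by scalars\<close>

definition annihilated :: "('o, 'm, 'r, 'x) linear_category_scheme \<Rightarrow> 'r set \<Rightarrow> 'o set" where
  "annihilated C M = {X \<in> Obj C. \<exists>r\<in>M. Scale C X X r (Ident C X) = Zero C X X}"

context is_linear_triangulated_category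
begin

lemma scalar_zero_Comp:
  assumes "X \<in> Obj C" "Y \<in> Obj C" "Scale C X X r (Ident C X) = Zero C X X" "r \<in> carrier R"
  shows "f \<in> Hom C X Y \<Longrightarrow> Scale C X Y r f = Zero C X Y"
    and "g \<in> Hom C Y X \<Longrightarrow> Scale C Y X r g = Zero C Y X"
proof -
  show "Scale C X Y r f = Zero C X Y" if "f \<in> Hom C X Y"
    using Comp_Scale_right[of X X Y r "Ident C X" f] that assms by (simp add: tri_simps)
  show "Scale C Y X r g = Zero C Y X" if "g \<in> Hom C Y X"
    using Comp_Scale_left[of Y X X r g "Ident C X"] that assms by (simp add: tri_simps)
qed

text \<open>
  As \<open>s\<close> kills \<open>B\<close>, the map \<open>s id\<^sub>X\<close> comes from a map to \<open>A\<close>, which \<open>r\<close> kills.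
\<close>

lemma scalar_zero_extension:
  assumes t: "(A, X, B, f, g, h) \<in> Tr"
    and r: "r \<in> carrier R" "Scale C A A r (Ident C A) = Zero C A A"
    and s: "s \<in> carrier R" "Scale C B B s (Ident C B) = Zero C B B"
  shows "Scale C X X (r \<otimes>\<^bsub>R\<^esub> s) (Ident C X) = Zero C X X"
proof -
  note p = triangle_parts[OF t]
  have k: "Scale C X X s (Ident C X) \<in> Hom C X X" using p s by (simp add: tri_simps)
  have "Comp C X X B g (Scale C X X s (Ident C X)) = Zero C X B"
    using scalar_zero_Comp(2)[OF p(3,2) s(2,1) p(5)] p s by (simp add: tri_simps)
  from factor_through_fibre[OF t p(2) k this] obtain l where
    l: "l \<in> Hom C X A" "Scale C X X s (Ident C X) = Comp C X A X f l" by blast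
  have "Scale C X X (r \<otimes>\<^bsub>R\<^esub> s) (Ident C X) = Scale C X X r (Scale C X X s (Ident C X))"
    using p r s by (simp add: tri_simps)
  also have "\<dots> = Comp C X A X f (Scale C X A r l)"
    unfolding l(2) using p r l(1) by (simp add: tri_simps)
  also have "Scale C X A r l = Zero C X A" using scalar_zero_Comp(2)[OF p(1,2) r(2,1) l(1)] .
  finally show ?thesis using p by (simp add: tri_simps)
qed

lemma scalar_zero_sh:
  assumes "X \<in> Obj C" "r \<in> carrier R"
  shows "Scale C (sh T X) (sh T X) r (Ident C (sh T X)) = Zero C (sh T X) (sh T X) \<longleftrightarrow>
    Scale C X X r (Ident C X) = Zero C X X"
proof -
  have "sh_mor T X X (Scale C X X r (Ident C X)) = Scale C (sh T X) (sh T X) r (Ident C (sh T X))"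
    using assms by (simp add: tri_simps shift_Scale)
  moreover have "sh_mor T X X (Zero C X X) = Zero C (sh T X) (sh T X)" using assms by (simp add: tri_simps)
  ultimately show ?thesis
    using sh_inj[of X X "Scale C X X r (Ident C X)" "Zero C X X"] assms by (auto simp: tri_simps)
qed

text \<open>
  On the cone of \<open>r id\<^sub>X\<close> the scalar \<open>r\<close> kills both neighbouring maps \<open>g\<close> and \<open>h\<close>. So \<open>r id\<^sub>Z = l h\<close>, and
  \<open>r\<^sup>2 id\<^sub>Z = l (r h) = 0\<close>. The scalar \<open>r\<close> itself need not kill \<open>Z\<close>.
\<close>

lemma scalar_zero_cone_of_scalar:
  assumes t: "(X, X, Z, Scale C X X r (Ident C X), g, h) \<in> Tr" and r: "r \<in> carrier R"
  shows "Scale C Z Z (r \<otimes>\<^bsub>R\<^esub> r) (Ident C Z) = Zero C Z Z"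
proof -
  note p = triangle_parts[OF t]
  have k: "Scale C Z Z r (Ident C Z) \<in> Hom C Z Z" using p r by (simp add: tri_simps)
  have "Comp C X Z Z (Scale C Z Z r (Ident C Z)) g = Zero C X Z"
    using triangle_comp_zero[OF t] p r by (simp add: tri_simps)
  from factor_through_cone[OF rotate[OF t] p(3) k this] obtain l where
    l: "l \<in> Hom C (sh T X) Z" "Scale C Z Z r (Ident C Z) = Comp C Z (sh T X) Z l h" by blast
  have rh: "Scale C Z (sh T X) r h \<in> Hom C Z (sh T X)" using p r by (simp add: tri_simps)
  have "Neg Z (sh T X) (Scale C Z (sh T X) r h) = Zero C Z (sh T X)"
    using triangle_comp_zero[OF rotate[OF rotate[OF t]]] p r by (simp add: tri_simps shift_Scale)
  then have "Scale C Z (sh T X) r h = Zero C Z (sh T X)"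
    using Neg_Neg[OF p(3) sh_obj[OF p(1)] rh] Neg_Zero[OF p(3) sh_obj[OF p(1)]] by simp
  moreover have "Scale C Z Z (r \<otimes>\<^bsub>R\<^esub> r) (Ident C Z) = Scale C Z Z r (Scale C Z Z r (Ident C Z))"
    using p r by (simp add: tri_simps)
  moreover have "\<dots> = Comp C Z (sh T X) Z l (Scale C Z (sh T X) r h)"
    unfolding l(2) using p r l(1) by (simp add: tri_simps)
  ultimately show ?thesis using p l(1) by (simp add: tri_simps)
qed

lemma annihilated_iso:
  assumes "X \<in> Obj C" "Y \<in> Obj C" "iso_mor C X Y u" "r \<in> carrier R"
    "Scale C X X r (Ident C X) = Zero C X X"
  shows "Scale C Y Y r (Ident C Y) = Zero C Y Y"
proof -
  obtain v where uv: "u \<in> Hom C X Y" "v \<in> Hom C Y X" "Comp C Y X Y u v = Ident C Y"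
    using assms(3) by (rule iso_morE)
  have "Scale C Y Y r (Ident C Y) = Comp C Y X Y (Scale C X Y r u) v"
    unfolding uv(3)[symmetric] using uv(1,2) assms by (simp add: tri_simps)
  also have "Scale C X Y r u = Zero C X Y" using scalar_zero_Comp(1)[OF assms(1,2,5,4) uv(1)] .
  finally show ?thesis using assms uv by (simp add: tri_simps)
qed

lemma annihilated_triangulated:
  assumes "submonoid M R"
  shows "triangulated_subcategory C T (annihilated C M)"
proof -
  interpret M: submonoid M R by fact
  have sub: "r \<in> carrier R" if "r \<in> M" for r using that M.subset by blast
  show ?thesis
    unfolding triangulated_subcategory_def
  proof (intro conjI allI ballI impI)
    show "annihilated C M \<subseteq> Obj C" by (auto simp: annihilated_def)
    show "Z \<in> annihilated C M" if "zero_object C Z" for Z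
      using that unfolding zero_object_iff annihilated_def
      by (auto intro!: bexI[OF _ M.one_closed] simp: Scale_one Zero_closed)
    show "Y \<in> annihilated C M" if a: "X \<in> annihilated C M" "Y \<in> Obj C" "\<exists>u. iso_mor C X Y u" for X Y
    proof -
      obtain u r where u: "iso_mor C X Y u" and r: "r \<in> M" "X \<in> Obj C" "Scale C X X r (Ident C X) = Zero C X X"
        using a unfolding annihilated_def by blast
      have "Scale C Y Y r (Ident C Y) = Zero C Y Y"
        by (rule annihilated_iso[OF r(2) a(2) u sub[OF r(1)] r(3)])
      then show ?thesis using a(2) r(1) unfolding annihilated_def by blast
    qed
    show "X \<in> annihilated C M \<longleftrightarrow> sh T X \<in> annihilated C M" if "X \<in> Obj C" for X
      using that sub by (auto simp: annihilated_def scalar_zero_sh sh_obj)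
    fix X Y Z f g h assume a: "(X, Y, Z, f, g, h) \<in> Tr \<and> X \<in> annihilated C M \<and> Y \<in> annihilated C M"
    then have t: "(X, Y, Z, f, g, h) \<in> Tr" by blast
    note p = triangle_parts[OF t]
    obtain r s where r: "r \<in> M" "Scale C X X r (Ident C X) = Zero C X X"
      and s: "s \<in> M" "Scale C Y Y s (Ident C Y) = Zero C Y Y"
      using a unfolding annihilated_def by blast
    have "Scale C Z Z (s \<otimes>\<^bsub>R\<^esub> r) (Ident C Z) = Zero C Z Z"
      using scalar_zero_extension[OF rotate[OF t]] scalar_zero_sh[OF p(1)] r s sub by simp
    then show "Z \<in> annihilated C M" using r s p M.m_closed unfolding annihilated_def by blast
  qed
qed

lemma triangulated_subcategory_Obj: "triangulated_subcategory C T (Obj C)"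
  unfolding triangulated_subcategory_def
proof (intro conjI allI ballI impI)
  fix X Y Z f g h assume "(X, Y, Z, f, g, h) \<in> Tr \<and> X \<in> Obj C \<and> Y \<in> Obj C"
  then show "Z \<in> Obj C" using triangle_parts(3) by blast
qed (auto simp: zero_object_def sh_obj)

lemma generated_subcategory_triangulated:
  assumes "A \<subseteq> Obj C"
  shows "triangulated_subcategory C T (generated_subcategory C T A)"
proof -
  have "generated_subcategory C T A \<subseteq> Obj C"
    unfolding generated_subcategory_def using assms triangulated_subcategory_Obj by blast
  then show ?thesis
    unfolding triangulated_subcategory_def
  proof (intro conjI allI ballI impI)
    show "Z \<in> generated_subcategory C T A" if "zero_object C Z" for Z
      using that unfolding generated_subcategory_def triangulated_subcategory_def by blast
    show "Y \<in> generated_subcategory C T A"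
      if "X \<in> generated_subcategory C T A" "Y \<in> Obj C" "\<exists>u. iso_mor C X Y u" for X Y
      using that unfolding generated_subcategory_def triangulated_subcategory_def by blast
    show "X \<in> generated_subcategory C T A \<longleftrightarrow> sh T X \<in> generated_subcategory C T A" if "X \<in> Obj C" for X
      using that unfolding generated_subcategory_def triangulated_subcategory_def by blast
    fix X Y Z f g h
    assume a: "(X, Y, Z, f, g, h) \<in> Tr \<and> X \<in> generated_subcategory C T A \<and> Y \<in> generated_subcategory C T A"
    have "Z \<in> K" if K: "A \<subseteq> K" "triangulated_subcategory C T K" for K
    proof -
      have "X \<in> K" "Y \<in> K" using a K unfolding generated_subcategory_def by blast+
      moreover have "\<forall>X Y Z f g h. (X, Y, Z, f, g, h) \<in> Tr \<and> X \<in> K \<and> Y \<in> K \<longrightarrow> Z \<in> K"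
        using K(2) unfolding triangulated_subcategory_def by (elim conjE)
      ultimately show ?thesis using a by blast
    qed
    then show "Z \<in> generated_subcategory C T A" unfolding generated_subcategory_def by simp
  qed
qed

lemma generated_by_scalar_cones_annihilated:
  assumes "submonoid (carrier R - p) R"
  shows "generated_subcategory C T (scalar_cones R p C T) \<subseteq> annihilated C (carrier R - p)"
proof -
  have "scalar_cones R p C T \<subseteq> annihilated C (carrier R - p)"
  proof
    fix Z assume "Z \<in> scalar_cones R p C T"
    then obtain r X g h where r: "r \<in> carrier R - p"
      and t: "(X, X, Z, Scale C X X r (Ident C X), g, h) \<in> Tr"
      unfolding scalar_cones_def by blast
    have "r \<otimes>\<^bsub>R\<^esub> r \<in> carrier R - p" using submonoid.m_closed[OF assms r r] .
    then show "Z \<in> annihilated C (carrier R - p)"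
      unfolding annihilated_def using scalar_zero_cone_of_scalar[OF t] triangle_parts(3)[OF t] r by blast
  qed
  then show ?thesis
    using annihilated_triangulated[OF assms] unfolding generated_subcategory_def by blast
qed

end

section \<open>Envelopes and central localizations\<close>

lemma (in is_linear_triangulated_category) envelope_closed:
  assumes "D \<subseteq> Obj C"
  shows "envelope C T D \<subseteq> Obj C" "D \<subseteq> envelope C T D"
    "extension_closed C T (envelope C T D)" "Karoubi_closed C (envelope C T D)"
proof -
  have "extension_closed C T (Obj C)" "Karoubi_closed C (Obj C)"
    unfolding extension_closed_def Karoubi_closed_def
    using triangle_parts(2) by (auto simp: zero_object_def retract_def)
  then show "envelope C T D \<subseteq> Obj C" unfolding envelope_def using assms by blast
  show "D \<subseteq> envelope C T D" unfolding envelope_def by blast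
  show "extension_closed C T (envelope C T D)"
    unfolding extension_closed_def
  proof (intro conjI allI impI)
    show "Z \<in> envelope C T D" if "zero_object C Z" for Z
      using that unfolding envelope_def extension_closed_def by blast
    fix A B X f g h
    assume a: "(A, X, B, f, g, h) \<in> Tr \<and> A \<in> envelope C T D \<and> B \<in> envelope C T D"
    have "X \<in> E" if E: "E \<subseteq> Obj C" "D \<subseteq> E" "extension_closed C T E" "Karoubi_closed C E" for E
    proof -
      have "A \<in> E" "B \<in> E" using a E unfolding envelope_def by blast+
      then show ?thesis using a E(3) unfolding extension_closed_def by blast
    qed
    then show "X \<in> envelope C T D" unfolding envelope_def by simp
  qed
  show "Karoubi_closed C (envelope C T D)"
    unfolding envelope_def Karoubi_closed_def by blast
qed

lemma envelope_least:
  "\<lbrakk>E \<subseteq> Obj C; D \<subseteq> E; extension_closed C T E; Karoubi_closed C E\<rbrakk> \<Longrightarrow> envelope C T D \<subseteq> E"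
  unfolding envelope_def by blast

lemma functor_Hom: "\<lbrakk>is_functor C C' F; X \<in> Obj C; Y \<in> Obj C; f \<in> Hom C X Y\<rbrakk>
    \<Longrightarrow> on_mor F X Y f \<in> Hom C' (on_obj F X) (on_obj F Y)"
  and functor_Ident: "\<lbrakk>is_functor C C' F; X \<in> Obj C\<rbrakk>
    \<Longrightarrow> on_mor F X X (Ident C X) = Ident C' (on_obj F X)"
  and functor_Comp: "\<lbrakk>is_functor C C' F; X \<in> Obj C; Y \<in> Obj C; Z \<in> Obj C; f \<in> Hom C X Y; g \<in> Hom C Y Z\<rbrakk>
    \<Longrightarrow> on_mor F X Z (Comp C X Y Z g f) =
      Comp C' (on_obj F X) (on_obj F Y) (on_obj F Z) (on_mor F Y Z g) (on_mor F X Y f)"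
  unfolding is_functor_def by blast+

lemma functor_iso_mor:
  assumes "is_functor C C' F" "X \<in> Obj C" "Y \<in> Obj C" "iso_mor C X Y w"
  shows "iso_mor C' (on_obj F X) (on_obj F Y) (on_mor F X Y w)"
proof -
  obtain v where v: "w \<in> Hom C X Y" "v \<in> Hom C Y X"
    "Comp C X Y X v w = Ident C X" "Comp C Y X Y w v = Ident C Y"
    using assms(4) unfolding iso_mor_def by blast
  show ?thesis
    unfolding iso_mor_def
    using functor_Comp[OF assms(1,2,3,2) v(1,2)] functor_Comp[OF assms(1,3,2,3) v(2,1)]
      functor_Ident[OF assms(1,2)] functor_Ident[OF assms(1,3)]
      functor_Hom[OF assms(1-3) v(1)] functor_Hom[OF assms(1,3,2) v(2)] v(3,4)
    by auto
qed

text \<open>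
  The situation of the theorem at one prime: \<open>C'\<close> plays the role of \<open>C\<^sub>p\<close>, and \<open>M\<close> that of the complement
  of the prime.
\<close>

locale central_localization = verdier_quotient R C T N + Q: is_linear_triangulated_category R' C' T'
  for R :: "('r, 'y) ring_scheme"
    and C :: "('o, 'm, 'r, 'x) linear_category_scheme"
    and T :: "('o, 'm, 'z) triangulation_scheme"
    and N :: "'o set"
    and R' :: "('r2, 'y2) ring_scheme"
    and C' :: "('o, 'm2, 'r2, 'x2) linear_category_scheme"
    and T' :: "('o, 'm2, 'z2) triangulation_scheme" +
  fixes L :: "('o, 'm, 'o, 'm2) cat_map" and M :: "'r set"
  assumes verdier: "isomorphic_to_verdier_functor C T N C' T' L"
    and same_Obj: "Obj C' = Obj C"
    and on_obj_L: "on_obj L X = X"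
    and denominators: "submonoid M R"
    and N_annihilated: "N \<subseteq> annihilated C M"
begin

abbreviation "\<Lambda> \<equiv> on_mor L"
abbreviation "VC \<equiv> verdier_category C T N"

lemma M_carrier: "r \<in> M \<Longrightarrow> r \<in> carrier R"
  and M_one: "\<one>\<^bsub>R\<^esub> \<in> M"
  and M_mult: "\<lbrakk>r \<in> M; s \<in> M\<rbrakk> \<Longrightarrow> r \<otimes>\<^bsub>R\<^esub> s \<in> M"
  using denominators by (auto dest: submonoid.subset submonoid.one_closed submonoid.m_closed)

lemma verdier_sel: "Obj VC = Obj C" "Ident VC X = V X X (Ident C X)"
  by (simp_all add: verdier_category_def)

text \<open>
  \<open>\<Phi>\<close> is the identity on objects, which turns the comparison into statements about morphisms with
  the same source and target.
\<close>

lemma L_isomorphism: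
  obtains \<Phi> where "is_functor VC C' \<Phi>" "fully_faithful VC C' \<Phi>"
    "\<And>X. X \<in> Obj C \<Longrightarrow> on_obj \<Phi> X = X" "\<And>X. X \<in> Obj C \<Longrightarrow> sh T' X = sh T X"
    "\<And>t. is_triangle VC (verdier_triangulation C T N) t \<Longrightarrow>
      t \<in> triangles (verdier_triangulation C T N) \<longleftrightarrow>
      map_triangle (verdier_triangulation C T N) \<Phi> t \<in> triangles T'"
    "\<And>X Y f. \<lbrakk>X \<in> Obj C; Y \<in> Obj C; f \<in> Hom C X Y\<rbrakk> \<Longrightarrow> on_mor \<Phi> X Y (V X Y f) = \<Lambda> X Y f"
proof -
  obtain \<Phi> where \<Phi>: "triangulated_isomorphism VC (verdier_triangulation C T N) C' T' \<Phi>"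
    and obj: "\<forall>X\<in>Obj C. on_obj \<Phi> (on_obj (verdier_functor C T N) X) = on_obj L X"
    and mor: "\<forall>X\<in>Obj C. \<forall>Y\<in>Obj C. \<forall>f\<in>Hom C X Y.
      on_mor \<Phi> X Y (on_mor (verdier_functor C T N) X Y f) = on_mor L X Y f"
    using verdier unfolding isomorphic_to_verdier_functor_def by blast
  have 1: "on_obj \<Phi> X = X" if "X \<in> Obj C" for X
    using obj that on_obj_L by (simp add: verdier_functor_def)
  have sh: "sh (verdier_triangulation C T N) = sh T"
    by (simp add: verdier_triangulation_def verdier_suspension_def)
  have "sh T' X = sh T X" if "X \<in> Obj C" for X
    using \<Phi> 1[OF that] 1[OF sh_obj[OF that]] that
    unfolding triangulated_isomorphism_def sh verdier_sel by metis
  then show thesis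
    using that[of \<Phi>] \<Phi> 1 mor unfolding triangulated_isomorphism_def verdier_functor_def by simp
qed

text \<open>
  The functor laws of \<open>L\<close> combine those of \<open>\<Phi>\<close> with those of the quotient functor.
\<close>

lemma L_Hom: "\<lbrakk>X \<in> Obj C; Y \<in> Obj C; f \<in> Hom C X Y\<rbrakk> \<Longrightarrow> \<Lambda> X Y f \<in> Hom C' X Y"
  and L_Ident: "X \<in> Obj C \<Longrightarrow> \<Lambda> X X (Ident C X) = Ident C' X"
  and L_Comp: "\<lbrakk>X \<in> Obj C; Y \<in> Obj C; Z \<in> Obj C; f \<in> Hom C X Y; g \<in> Hom C Y Z\<rbrakk>
    \<Longrightarrow> \<Lambda> X Z (Comp C X Y Z g f) = Comp C' X Y Z (\<Lambda> Y Z g) (\<Lambda> X Y f)"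
proof -
  obtain \<Phi> where F: "is_functor VC C' \<Phi>"
    and o: "\<And>X. X \<in> Obj C \<Longrightarrow> on_obj \<Phi> X = X"
    and m: "\<And>X Y f. \<lbrakk>X \<in> Obj C; Y \<in> Obj C; f \<in> Hom C X Y\<rbrakk> \<Longrightarrow> on_mor \<Phi> X Y (V X Y f) = \<Lambda> X Y f"
    by (rule L_isomorphism) blast
  have id: "on_mor \<Phi> X X (Ident VC X) = Ident C' X" if "X \<in> Obj C" for X
    using functor_Ident[OF F] that by (simp add: verdier_sel(1) o)
  have hom: "on_mor \<Phi> X Y \<alpha> \<in> Hom C' X Y" if "X \<in> Obj C" "Y \<in> Obj C" "\<alpha> \<in> Hom VC X Y" for X Y \<alpha>
    using functor_Hom[OF F] that by (simp add: verdier_sel(1) o)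
  have comp: "on_mor \<Phi> X Z (Comp VC X Y Z \<beta> \<alpha>) = Comp C' X Y Z (on_mor \<Phi> Y Z \<beta>) (on_mor \<Phi> X Y \<alpha>)"
    if "X \<in> Obj C" "Y \<in> Obj C" "Z \<in> Obj C" "\<alpha> \<in> Hom VC X Y" "\<beta> \<in> Hom VC Y Z" for X Y Z \<alpha> \<beta>
    using functor_Comp[OF F] that by (simp add: verdier_sel(1) o)
  show "\<Lambda> X Y f \<in> Hom C' X Y" if "X \<in> Obj C" "Y \<in> Obj C" "f \<in> Hom C X Y" for X Y f
    using hom[OF that(1,2) verdier_functor_Hom[OF that(1,3)]] m[OF that] by simp
  show "\<Lambda> X X (Ident C X) = Ident C' X" if "X \<in> Obj C" for X
    using m[OF that that Ident_closed[OF that]] id[OF that] by (simp add: verdier_sel)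
  show "\<Lambda> X Z (Comp C X Y Z g f) = Comp C' X Y Z (\<Lambda> Y Z g) (\<Lambda> X Y f)"
    if a: "X \<in> Obj C" "Y \<in> Obj C" "Z \<in> Obj C" "f \<in> Hom C X Y" "g \<in> Hom C Y Z" for X Y Z f g
    using comp[OF a(1-3) verdier_functor_Hom[OF a(1,4)] verdier_functor_Hom[OF a(2,5)]]
      verdier_functor_Comp[OF a] m a by (simp add: Comp_closed)
qed

text \<open>
  Morphisms equal in the quotient agree after composition with some \<open>w\<close> whose cone \<open>Q\<close> lies in \<open>N\<close>. Their
  difference then factors through \<open>Q\<close> and is killed by any scalar that kills \<open>Q\<close>.
\<close>

lemma L_eqD:
  assumes X: "X \<in> Obj C" "Y \<in> Obj C" and f: "f \<in> Hom C X Y" "g \<in> Hom C X Y" and eq: "\<Lambda> X Y f = \<Lambda> X Y g"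
  obtains u where "u \<in> M" "Scale C X Y u f = Scale C X Y u g"
proof -
  obtain \<Phi> where F: "fully_faithful VC C' \<Phi>"
    and m: "\<And>X Y f. \<lbrakk>X \<in> Obj C; Y \<in> Obj C; f \<in> Hom C X Y\<rbrakk> \<Longrightarrow> on_mor \<Phi> X Y (V X Y f) = \<Lambda> X Y f"
    by (rule L_isomorphism) blast
  have "inj_on (on_mor \<Phi> X Y) (Hom VC X Y)"
    using F X unfolding fully_faithful_def verdier_sel(1) bij_betw_def by blast
  then have "V X Y f = V X Y g"
    by (rule inj_onD) (use eq m X f verdier_functor_Hom in simp_all)
  from verdier_functor_eqD[OF X f this] obtain W w where W: "W \<in> Obj C" "w \<in> S W X"
    and fw: "Comp C W X Y f w = Comp C W X Y g w" by blast
  obtain Q q r where t: "(W, X, Q, w, q, r) \<in> Tr" "Q \<in> N" using W(2) by (rule S_E)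
  note p = triangle_parts[OF t(1)]
  obtain u where u: "u \<in> M" "Scale C Q Q u (Ident C Q) = Zero C Q Q"
    using N_annihilated t(2) unfolding annihilated_def by blast
  note uR = M_carrier[OF u(1)]
  define d where "d = Add C X Y f (Neg X Y g)"
  have d: "d \<in> Hom C X Y" using X f by (simp add: d_def tri_simps)
  have "Comp C W X Y d w = Zero C W Y"
    unfolding d_def using X f fw p by (simp add: tri_simps Comp_Add_left Add_Neg_right)
  from factor_through_cone[OF t(1) X(2) d this] obtain l where
    l: "l \<in> Hom C Q Y" "d = Comp C X Q Y l q" by blast
  have "Scale C X Y u d = Comp C X Q Y (Scale C Q Y u l) q"
    unfolding l(2) using l(1) p X uR by (simp add: tri_simps)
  also have "\<dots> = Zero C X Y"
    using scalar_zero_Comp(1)[OF p(3) X(2) u(2) uR l(1)] p X by (simp add: tri_simps)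
  finally have "Add C X Y (Scale C X Y u f) (Neg X Y (Scale C X Y u g)) = Zero C X Y"
    using X f uR by (simp add: d_def tri_simps Scale_add_right Neg_Scale)
  then have "Scale C X Y u f = Scale C X Y u g"
    by (rule Add_Neg_eq_Zero[rotated 4]) (use X f uR in \<open>simp_all add: tri_simps\<close>)
  then show ?thesis using that u by blast
qed

text \<open>
  Let \<open>\<alpha> = f s\<inverse>\<close>, and let \<open>u\<close> kill the cone of \<open>s\<close>. Then \<open>u id\<^sub>X\<close> lifts along \<open>s\<close>, say to \<open>e\<close>, and
  \<open>\<alpha> u = f s\<inverse> s e = f e\<close>.
\<close>

lemma L_clear_denominator:
  assumes X: "X \<in> Obj C" "Y \<in> Obj C" and \<alpha>: "\<alpha> \<in> Hom C' X Y"
  obtains u f where "u \<in> M" "f \<in> Hom C X Y"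
    "Comp C' X X Y \<alpha> (\<Lambda> X X (Scale C X X u (Ident C X))) = \<Lambda> X Y f"
proof -
  obtain \<Phi> where F: "is_functor VC C' \<Phi>" and FF: "fully_faithful VC C' \<Phi>"
    and o: "\<And>X. X \<in> Obj C \<Longrightarrow> on_obj \<Phi> X = X"
    and m: "\<And>X Y f. \<lbrakk>X \<in> Obj C; Y \<in> Obj C; f \<in> Hom C X Y\<rbrakk> \<Longrightarrow> on_mor \<Phi> X Y (V X Y f) = \<Lambda> X Y f"
    by (rule L_isomorphism) blast
  have "on_mor \<Phi> X Y ` Hom VC X Y = Hom C' X Y"
    using FF X o unfolding fully_faithful_def verdier_sel(1) bij_betw_def by metis
  then obtain \<rho> where \<rho>: "\<rho> \<in> Hom VC X Y" "\<alpha> = on_mor \<Phi> X Y \<rho>" using \<alpha> by blast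
  then obtain Z s f where Z: "Z \<in> Obj C" "s \<in> S Z X" "f \<in> Hom C Z Y"
    and \<rho>': "\<rho> = roof_class C T N X Y (Z, s, f)"
    unfolding verdier_category_def roofs_def by auto
  note s = S_Hom[OF Z(2)]
  obtain Q q r where t: "(Z, X, Q, s, q, r) \<in> Tr" "Q \<in> N" using Z(2) by (rule S_E)
  note p = triangle_parts[OF t(1)]
  obtain u where u: "u \<in> M" "Scale C Q Q u (Ident C Q) = Zero C Q Q"
    using N_annihilated t(2) unfolding annihilated_def by blast
  note uR = M_carrier[OF u(1)]
  have uX: "Scale C X X u (Ident C X) \<in> Hom C X X" using X uR by (simp add: tri_simps)
  have "Comp C X X Q q (Scale C X X u (Ident C X)) = Zero C X Q"
    using scalar_zero_Comp(2)[OF p(3) X(1) u(2) uR p(5)] p uR by (simp add: tri_simps)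
  from factor_through_fibre[OF t(1) X(1) uX this] obtain e where
    e: "e \<in> Hom C X Z" "Scale C X X u (Ident C X) = Comp C X Z X s e" by blast
  have "Comp VC X X Y \<rho> (V X X (Scale C X X u (Ident C X))) = V X Y (Comp C X Z Y f e)"
    unfolding \<rho>' e(2) by (rule verdier_Comp_numerator[OF X(1,1,2) Z(1-3) e(1)])
  moreover have "on_mor \<Phi> X Y (Comp VC X X Y \<rho> (V X X (Scale C X X u (Ident C X)))) =
      Comp C' X X Y (on_mor \<Phi> X Y \<rho>) (on_mor \<Phi> X X (V X X (Scale C X X u (Ident C X))))"
    using functor_Comp[OF F _ _ _ verdier_functor_Hom[OF X(1) uX] \<rho>(1)] X by (simp add: verdier_sel(1) o)
  moreover have fe: "Comp C X Z Y f e \<in> Hom C X Y" using X Z e by (simp add: tri_simps)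
  ultimately have "Comp C' X X Y \<alpha> (\<Lambda> X X (Scale C X X u (Ident C X))) = \<Lambda> X Y (Comp C X Z Y f e)"
    using m X uX \<rho>(2) o by simp
  then show ?thesis using that u fe by blast
qed

lemma L_exact:
  assumes "(X, Y, Z, f, g, h) \<in> Tr"
  shows "(X, Y, Z, \<Lambda> X Y f, \<Lambda> Y Z g, \<Lambda> Z (sh T X) h) \<in> triangles T'"
proof -
  note p = triangle_parts[OF assms]
  obtain \<Phi> where o: "\<And>X. X \<in> Obj C \<Longrightarrow> on_obj \<Phi> X = X"
    and t: "\<And>t. is_triangle VC (verdier_triangulation C T N) t \<Longrightarrow>
      t \<in> triangles (verdier_triangulation C T N) \<longleftrightarrow>
      map_triangle (verdier_triangulation C T N) \<Phi> t \<in> triangles T'"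
    and m: "\<And>X Y f. \<lbrakk>X \<in> Obj C; Y \<in> Obj C; f \<in> Hom C X Y\<rbrakk> \<Longrightarrow> on_mor \<Phi> X Y (V X Y f) = \<Lambda> X Y f"
    by (rule L_isomorphism) blast
  have sh: "sh (verdier_triangulation C T N) = sh T"
    by (simp add: verdier_triangulation_def verdier_suspension_def)
  let ?t = "(X, Y, Z, V X Y f, V Y Z g, V Z (sh T X) h)"
  have "?t \<in> triangles (verdier_triangulation C T N)"
    using verdier_functor_exact[OF assms] by (simp add: verdier_functor_def)
  moreover have "is_triangle VC (verdier_triangulation C T N) ?t"
    using p by (simp add: verdier_sel sh verdier_functor_Hom)
  ultimately have "map_triangle (verdier_triangulation C T N) \<Phi> ?t \<in> triangles T'" using t by blast
  then show ?thesis using p by (simp add: sh o m sh_obj)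
qed

text \<open>
  Only the objects of the triangle are compared, since this is all that closure properties of isomorphism-closed
  classes of objects require.
\<close>

lemma triangle_lift:
  assumes t: "(A, X, B, f, g, h) \<in> triangles T'"
  obtains A' X' B' f' g' h' a x b where "(A', X', B', f', g', h') \<in> Tr"
    "iso_mor C' A' A a" "iso_mor C' X' X x" "iso_mor C' B' B b"
proof -
  have p: "A \<in> Obj C" "X \<in> Obj C" "B \<in> Obj C" "f \<in> Hom C' A X" "g \<in> Hom C' X B" "h \<in> Hom C' B (sh T' A)"
    using Q.triangle_parts[OF t] same_Obj by auto
  obtain \<Phi> where F: "is_functor VC C' \<Phi>" and FF: "fully_faithful VC C' \<Phi>"
    and o: "\<And>X. X \<in> Obj C \<Longrightarrow> on_obj \<Phi> X = X" and shT: "\<And>X. X \<in> Obj C \<Longrightarrow> sh T' X = sh T X"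
    and tr: "\<And>t. is_triangle VC (verdier_triangulation C T N) t \<Longrightarrow>
      t \<in> triangles (verdier_triangulation C T N) \<longleftrightarrow>
      map_triangle (verdier_triangulation C T N) \<Phi> t \<in> triangles T'"
    by (rule L_isomorphism) blast
  have sh: "sh (verdier_triangulation C T N) = sh T"
    by (simp add: verdier_triangulation_def verdier_suspension_def)
  have full: "on_mor \<Phi> X Y ` Hom VC X Y = Hom C' X Y" if "X \<in> Obj C" "Y \<in> Obj C" for X Y
    using FF that o unfolding fully_faithful_def verdier_sel(1) bij_betw_def by metis
  obtain f0 where f0: "f0 \<in> Hom VC A X" "f = on_mor \<Phi> A X f0" using p(4) full[OF p(1,2)] by blast
  obtain g0 where g0: "g0 \<in> Hom VC X B" "g = on_mor \<Phi> X B g0" using p(5) full[OF p(2,3)] by blast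
  obtain h0 where h0: "h0 \<in> Hom VC B (sh T A)" "h = on_mor \<Phi> B (sh T A) h0"
    using p(6) full[OF p(3) sh_obj[OF p(1)]] shT[OF p(1)] by auto
  have "is_triangle VC (verdier_triangulation C T N) (A, X, B, f0, g0, h0)"
    using f0 g0 h0 p by (simp add: verdier_sel sh)
  moreover have "map_triangle (verdier_triangulation C T N) \<Phi> (A, X, B, f0, g0, h0) \<in> triangles T'"
    using t p f0 g0 h0 by (simp add: o sh)
  ultimately have "(A, X, B, f0, g0, h0) \<in> triangles (verdier_triangulation C T N)" using tr by blast
  then obtain t' where t': "t' \<in> Tr" "triangle_iso VC (verdier_suspension C T N)
      (map_triangle T (verdier_functor C T N) t') (A, X, B, f0, g0, h0)"
    unfolding verdier_triangulation_def by auto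
  obtain A' X' B' f' g' h' where t'_eq: "t' = (A', X', B', f', g', h')" by (cases t') blast
  note p' = triangle_parts[OF t'(1)[unfolded t'_eq]]
  obtain a x b where iso: "iso_mor VC A' A a" "iso_mor VC X' X x" "iso_mor VC B' B b"
    using t'(2) unfolding t'_eq by (auto simp: verdier_functor_def)
  have "iso_mor C' U W (on_mor \<Phi> U W w)" if "iso_mor VC U W w" "U \<in> Obj C" "W \<in> Obj C" for U W w
    using functor_iso_mor[OF F _ _ that(1)] that(2,3) by (simp add: verdier_sel o)
  from that[OF t'(1)[unfolded t'_eq] this[OF iso(1) p'(1) p(1)] this[OF iso(2) p'(2) p(2)]
      this[OF iso(3) p'(3) p(3)]] show ?thesis .
qed

lemma L_retract: "retract C X Y \<Longrightarrow> retract C' X Y"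
  unfolding retract_def using L_Comp L_Ident L_Hom same_Obj by metis

text \<open>
  Both composites \<open>Z \<rightarrow> Z' \<rightarrow> Z\<close> and \<open>Z' \<rightarrow> Z \<rightarrow> Z'\<close> are identities, because a zero object has no other
  endomorphism.
\<close>

lemma L_zero_object:
  assumes "zero_object C Z" "zero_object C' Z'"
  shows "retract C' Z Z'" "retract C' Z' Z"
proof -
  have Z: "Z \<in> Obj C" "Z' \<in> Obj C" using assms same_Obj by (auto simp: zero_object_def)
  have "retract C Z Z'"
    using assms(1) Z by (intro retractI[of _ _ _ "Zero C Z Z'" "Zero C Z' Z"]) (auto simp: tri_simps zero_object_iff)
  then show "retract C' Z Z'" by (rule L_retract)
  show "retract C' Z' Z"
    using assms(2) Z same_Obj
    by (intro retractI[of _ _ _ "Zero C' Z' Z" "Zero C' Z Z'"]) (auto simp: Q.tri_simps Q.zero_object_iff)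
qed

text \<open>
  The envelope formed in \<open>C'\<close> is closed in \<open>C\<close>, because \<open>L\<close> preserves distinguished triangles and retracts.
\<close>

lemma envelope_image:
  assumes D: "D \<subseteq> Obj C"
  shows "envelope C T D \<subseteq> envelope C' T' D"
proof (rule envelope_least)
  note env = Q.envelope_closed[OF D[folded same_Obj]]
  show "envelope C' T' D \<subseteq> Obj C" "D \<subseteq> envelope C' T' D" using env same_Obj by auto
  show "Karoubi_closed C (envelope C' T' D)"
    using env(4) L_retract unfolding Karoubi_closed_def by blast
  obtain Z' where Z': "zero_object C' Z'" using Q.ex_zero_object by blast
  then have "Z' \<in> envelope C' T' D" using env(3) unfolding extension_closed_def by blast
  then have "Z \<in> envelope C' T' D" if "zero_object C Z" for Z
    using L_zero_object(1)[OF that Z'] env(4) unfolding Karoubi_closed_def by blast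
  moreover have "X \<in> envelope C' T' D" if "(A, X, B, f, g, h) \<in> Tr" "A \<in> envelope C' T' D" "B \<in> envelope C' T' D" for A X B f g h
    using L_exact[OF that(1)] that(2,3) env(3) unfolding extension_closed_def by blast
  ultimately show "extension_closed C T (envelope C' T' D)" unfolding extension_closed_def by blast
qed

text \<open>
  Clearing denominators in \<open>i\<close> and \<open>\<rho>\<close> gives \<open>i' = i u\<close> and \<open>\<rho>' = \<rho> v\<close> in \<open>C\<close> with
  \<open>\<rho>' i' = u v id\<^sub>X\<close> in \<open>C'\<close>, hence \<open>w \<rho>' i' = w u v id\<^sub>X\<close> in \<open>C\<close> for some \<open>w \<in> M\<close>. Inserting the
  factorization of \<open>s id\<^sub>Y\<close> between \<open>i'\<close> and \<open>\<rho>'\<close> makes \<open>s w u v id\<^sub>X\<close> factor.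
\<close>

lemma scalar_factors_retract:
  assumes E: "E \<subseteq> Obj C" and ret: "retract C' X Y" and s: "s \<in> M" "scalar_factors C E Y s"
  obtains r where "r \<in> M" "scalar_factors C E X r"
proof -
  obtain i \<rho> where X: "X \<in> Obj C" "Y \<in> Obj C" and i: "i \<in> Hom C' X Y" "\<rho> \<in> Hom C' Y X"
    and \<rho>i: "Comp C' X Y X \<rho> i = Ident C' X" using ret same_Obj unfolding retract_def by auto
  note X' = X[folded same_Obj]
  obtain u i' where u: "u \<in> M" "i' \<in> Hom C X Y"
    and iu: "Comp C' X X Y i (\<Lambda> X X (Scale C X X u (Ident C X))) = \<Lambda> X Y i'"
    by (rule L_clear_denominator[OF X i(1)])
  obtain v \<rho>' where v: "v \<in> M" "\<rho>' \<in> Hom C Y X"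
    and \<rho>v: "Comp C' Y Y X \<rho> (\<Lambda> Y Y (Scale C Y Y v (Ident C Y))) = \<Lambda> Y X \<rho>'"
    by (rule L_clear_denominator[OF X(2,1) i(2)])
  note R = M_carrier[OF u(1)] M_carrier[OF v(1)] M_carrier[OF s(1)]
  let ?u = "Scale C X X u (Ident C X)" and ?v = "Scale C X X v (Ident C X)" and ?v' = "Scale C Y Y v (Ident C Y)"
  have sc: "?u \<in> Hom C X X" "?v \<in> Hom C X X" "?v' \<in> Hom C Y Y" using X R by (simp_all add: tri_simps)
  note LH = L_Hom[OF X(1,1) sc(1)] L_Hom[OF X(1,1) sc(2)] L_Hom[OF X(2,2) sc(3)] L_Hom[OF X u(2)] L_Hom[OF X(2,1) v(2)]
  have "\<Lambda> X X (Comp C X Y X \<rho>' i') = Comp C' X Y X (Comp C' Y Y X \<rho> (\<Lambda> Y Y ?v')) (\<Lambda> X Y i')"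
    unfolding \<rho>v using L_Comp[OF X X(1) u(2) v(2)] .
  also have "\<dots> = Comp C' X Y X \<rho> (\<Lambda> X Y (Comp C X Y Y ?v' i'))"
    using Q.Comp_assoc[OF X'(1,2,2,1) LH(4,3) i(2)] L_Comp[OF X X(2) u(2) sc(3)] by simp
  also have "Comp C X Y Y ?v' i' = Comp C X X Y i' ?v" using X u R by (simp add: tri_simps)
  also have "\<Lambda> X Y \<dots> = Comp C' X X Y i (\<Lambda> X X (Comp C X X X ?u ?v))"
    using L_Comp[OF X(1,1,2) sc(2) u(2)] L_Comp[OF X(1,1,1) sc(2,1)]
      Q.Comp_assoc[OF X'(1,1,1,2) LH(2,1) i(1)] iu by simp
  also have "Comp C' X Y X \<rho> \<dots> = \<Lambda> X X (Comp C X X X ?u ?v)"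
    using Q.Comp_assoc[OF X'(1,1,2,1) L_Hom[OF X(1,1) Comp_closed[OF X(1,1,1) sc(2,1)]] i] \<rho>i
      L_Hom[OF X(1,1) Comp_closed[OF X(1,1,1) sc(2,1)]] X' by (simp add: Q.Comp_Ident_left)
  also have "Comp C X X X ?u ?v = Scale C X X (u \<otimes>\<^bsub>R\<^esub> v) (Ident C X)" using X R by (simp add: tri_simps scalars.m_comm)
  finally have eq: "\<Lambda> X X (Comp C X Y X \<rho>' i') = \<Lambda> X X (Scale C X X (u \<otimes>\<^bsub>R\<^esub> v) (Ident C X))" .
  obtain w where w: "w \<in> M" "Scale C X X w (Comp C X Y X \<rho>' i') =
      Scale C X X w (Scale C X X (u \<otimes>\<^bsub>R\<^esub> v) (Ident C X))"
    by (rule L_eqD[OF X(1,1) _ _ eq]) (use X u v R in \<open>simp_all add: tri_simps\<close>)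
  obtain e j k where e: "e \<in> E" "j \<in> Hom C Y e" "k \<in> Hom C e Y"
    and kj: "Comp C Y e Y k j = Scale C Y Y s (Ident C Y)" using s(2) unfolding scalar_factors_def by blast
  have eo: "e \<in> Obj C" using e E by blast
  note h = X u(2) v(2) R M_carrier[OF w(1)] e(2,3) eo
  let ?r = "s \<otimes>\<^bsub>R\<^esub> (w \<otimes>\<^bsub>R\<^esub> (u \<otimes>\<^bsub>R\<^esub> v))"
  have "Comp C X e X (Comp C e Y X \<rho>' k) (Scale C X e w (Comp C X Y e j i')) =
      Scale C X X w (Comp C X Y X \<rho>' (Comp C X Y Y (Comp C Y e Y k j) i'))"
    using h by (simp add: tri_simps Comp_assoc)
  also have "\<dots> = Scale C X X s (Scale C X X w (Comp C X Y X \<rho>' i'))"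
    unfolding kj using h by (simp add: tri_simps scalars.m_comm)
  also have "\<dots> = Scale C X X ?r (Ident C X)"
    unfolding w(2) using h by (simp add: tri_simps scalars.m_assoc)
  finally have "scalar_factors C E X ?r"
    by (rule scalar_factorsI[OF e(1), rotated 2]) (use h in \<open>simp_all add: tri_simps\<close>)
  moreover have "?r \<in> M" using s u v w M_mult by blast
  ultimately show ?thesis using that by blast
qed

text \<open>
  The class \<open>P\<close> of all objects satisfying the conclusion contains \<open>D\<close> and is closed in \<open>C'\<close>. A triangle of
  \<open>C'\<close> is first replaced by an isomorphic one coming from \<open>C\<close>; this is harmless because \<open>P\<close> is closed under
  retracts in \<open>C'\<close>, and lets \<open>scalar_factors_extension\<close> apply.
\<close>

lemma envelope_local:
  assumes D: "D \<subseteq> Obj C" and Y: "Y \<in> envelope C' T' D"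
  obtains r where "r \<in> M" "scalar_factors C (envelope C T D) Y r"
proof -
  let ?E = "envelope C T D"
  note env = envelope_closed[OF D]
  define P where "P = {X \<in> Obj C. \<exists>r\<in>M. scalar_factors C ?E X r}"
  have E_P: "?E \<subseteq> P"
  proof
    fix X assume X: "X \<in> ?E"
    then have XO: "X \<in> Obj C" using env by blast
    then have "scalar_factors C ?E X \<one>\<^bsub>R\<^esub>"
      by (intro scalar_factorsI[OF X Ident_closed Ident_closed]) (simp_all add: tri_simps)
    then show "X \<in> P" unfolding P_def using M_one XO by blast
  qed
  have ret: "X \<in> P" if r: "retract C' X Y" and YP: "Y \<in> P" for X Y
  proof -
    have X: "X \<in> Obj C" using r same_Obj unfolding retract_def by simp
    obtain s where s: "s \<in> M" "scalar_factors C ?E Y s" using YP unfolding P_def by blast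
    obtain r' where "r' \<in> M" "scalar_factors C ?E X r'" by (rule scalar_factors_retract[OF env(1) r s])
    then show ?thesis unfolding P_def using X by blast
  qed
  have ext: "X \<in> P" if t: "(A, X, B, f, g, h) \<in> triangles T'" and AB: "A \<in> P" "B \<in> P" for A X B f g h
  proof -
    note pq = Q.triangle_parts(1-3)[OF t]
    obtain A' X' B' f' g' h' a x b where t': "(A', X', B', f', g', h') \<in> Tr"
      and iso: "iso_mor C' A' A a" "iso_mor C' X' X x" "iso_mor C' B' B b" by (rule triangle_lift[OF t])
    note p = triangle_parts[OF t']
    have "A' \<in> P" "B' \<in> P"
      using ret Q.iso_mor_retract iso AB p pq same_Obj by metis+
    then obtain r s where r: "r \<in> M" "scalar_factors C ?E A' r" and s: "s \<in> M" "scalar_factors C ?E B' s"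
      unfolding P_def by blast
    have "X' \<in> P"
      using scalar_factors_extension[OF env(3,1) t' M_carrier[OF r(1)] r(2) M_carrier[OF s(1)] s(2)]
        M_mult[OF M_mult M_mult, OF r(1) s(1) r(1) s(1)] p unfolding P_def by blast
    moreover obtain y where "iso_mor C' X X' y" using iso(2) by (rule Q.iso_mor_sym)
    ultimately show ?thesis using ret Q.iso_mor_retract p pq same_Obj by metis
  qed
  have zero: "Z \<in> P" if Z: "zero_object C' Z" for Z
  proof -
    obtain O' where O: "zero_object C O'" "O' \<in> Obj C" by (rule ex_zero)
    then have "O' \<in> P" using env(3) E_P unfolding extension_closed_def by blast
    then show ?thesis using ret L_zero_object(2)[OF O(1) Z] by blast
  qed
  have "envelope C' T' D \<subseteq> P"
  proof (rule envelope_least)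
    show "P \<subseteq> Obj C'" unfolding P_def same_Obj by blast
    show "D \<subseteq> P" using env E_P by blast
    show "extension_closed C' T' P" unfolding extension_closed_def using zero ext by blast
    show "Karoubi_closed C' P" unfolding Karoubi_closed_def using ret by blast
  qed
  then show ?thesis using Y that unfolding P_def by blast
qed

end

section \<open>The local-global principle\<close>

lemma (in cring) ex_maximalideal_above:
  assumes I: "ideal I R" "\<one> \<notin> I"
  obtains p where "maximalideal p R" "I \<subseteq> p"
proof -
  let ?A = "{J. ideal J R \<and> I \<subseteq> J \<and> \<one> \<notin> J}"
  have "\<exists>M\<in>?A. \<forall>X\<in>?A. M \<subseteq> X \<longrightarrow> X = M"
  proof (rule subset_Zorn_nonempty)
    show "?A \<noteq> {}" using I by blast
    fix \<C> assume ne: "\<C> \<noteq> {}" and ch: "subset.chain ?A \<C>"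
    then have "subset.chain {J. ideal J R} \<C>" by (auto simp: subset_chain_def)
    from chain_Union_is_ideal[OF this] ne have "ideal (\<Union>\<C>) R" by simp
    then show "\<Union>\<C> \<in> ?A" using ch ne by (fastforce simp: subset_chain_def)
  qed
  then obtain M where M: "M \<in> ?A" and max: "\<forall>X\<in>?A. M \<subseteq> X \<longrightarrow> X = M" ..
  have M: "ideal M R" "I \<subseteq> M" "\<one> \<notin> M" using M by auto
  have "maximalideal M R"
  proof (rule maximalidealI[OF M(1)])
    show "carrier R \<noteq> M" using M(3) one_closed by metis
    fix J assume J: "ideal J R" "M \<subseteq> J" "J \<subseteq> carrier R"
    show "J = M \<or> J = carrier R"
    proof (cases "\<one> \<in> J")
      case True
      then show ?thesis using ideal.one_imp_carrier[OF J(1)] by simp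
    next
      case False
      then have "J \<in> ?A" using J M(2) by auto
      then show ?thesis using max J(2) by blast
    qed
  qed
  then show ?thesis using that M(2) by blast
qed

lemma (in primeideal) submonoid_complement: "submonoid (carrier R - I) R"
proof
  show "\<one> \<in> carrier R - I" using I_notcarr one_imp_carrier by auto
qed (use I_prime in auto)

theorem corollary0p2:
  fixes R :: "'r ring"
    and C :: "('o, 'm, 'r) linear_category"
    and T :: "('o, 'm) triangulation"
    and Tp :: "'r set \<Rightarrow> ('o, (('m \<times> ('r \<times> 'r) set) \<Rightarrow>\<^sub>0 int) set) triangulation"
    and D :: "'o set" and Y :: 'o
  assumes "cring R"
    and "is_linear_triangulated_category R C T"
    and "\<And>p. maximalideal p R \<Longrightarrow> is_loc_triangulation R p C T (Tp p)"
    and "D \<subseteq> Obj C" and "Y \<in> Obj C"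
  shows "Y \<in> envelope C T D \<longleftrightarrow>
    (\<forall>p. maximalideal p R \<longrightarrow>
       on_obj (loc_functor R p C) Y
         \<in> envelope (loc_category R p C) (Tp p) (on_obj (loc_functor R p C) ` D))"
proof -
  interpret is_linear_triangulated_category R C T by fact
  have on_obj: "on_obj (loc_functor R p C) X = X" for p X by (simp add: loc_functor_def)
  have loc: "central_localization R C T (generated_subcategory C T (scalar_cones R p C T))
      (localization_at R p) (loc_category R p C) (Tp p) (loc_functor R p C) (carrier R - p)"
    if p: "maximalideal p R" for p
  proof -
    have S: "submonoid (carrier R - p) R"
      using scalars.maximalideal_prime[OF p] by (rule primeideal.submonoid_complement)
    have cones: "scalar_cones R p C T \<subseteq> Obj C"
      unfolding scalar_cones_def using triangle_parts(3) by blast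
    have Tp: "is_linear_triangulated_category (localization_at R p) (loc_category R p C) (Tp p)"
      "isomorphic_to_verdier_functor C T (generated_subcategory C T (scalar_cones R p C T))
        (loc_category R p C) (Tp p) (loc_functor R p C)"
      using assms(3)[OF p] unfolding is_loc_triangulation_def by blast+
    show ?thesis
    proof (intro central_localization.intro verdier_quotient.intro central_localization_axioms.intro
        verdier_quotient_axioms.intro)
      show "generated_subcategory C T (scalar_cones R p C T) \<subseteq> annihilated C (carrier R - p)"
        by (rule generated_by_scalar_cones_annihilated[OF S])
      show "Obj (loc_category R p C) = Obj C" by (simp add: loc_category_def)
    qed (use assms(2) Tp S on_obj generated_subcategory_triangulated[OF cones] in auto)
  qed
  have local: "Y \<in> envelope C T D \<longleftrightarrow>
      (\<forall>p. maximalideal p R \<longrightarrow> Y \<in> envelope (loc_category R p C) (Tp p) D)"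
  proof
    assume "Y \<in> envelope C T D"
    then show "\<forall>p. maximalideal p R \<longrightarrow> Y \<in> envelope (loc_category R p C) (Tp p) D"
      using central_localization.envelope_image[OF loc assms(4)] by blast
  next
    assume Y: "\<forall>p. maximalideal p R \<longrightarrow> Y \<in> envelope (loc_category R p C) (Tp p) D"
    note env = envelope_closed[OF assms(4)]
    let ?I = "{r \<in> carrier R. scalar_factors C (envelope C T D) Y r}"
    have I: "ideal ?I R" by (rule scalar_factors_ideal[OF env(3,4,1) assms(5)])
    have "\<one>\<^bsub>R\<^esub> \<in> ?I"
    proof (rule ccontr)
      assume "\<one>\<^bsub>R\<^esub> \<notin> ?I"
      then obtain p where p: "maximalideal p R" "?I \<subseteq> p" by (rule scalars.ex_maximalideal_above[OF I])
      have Yp: "Y \<in> envelope (loc_category R p C) (Tp p) D" using Y p(1) by blast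
      obtain r where "r \<in> carrier R - p" "scalar_factors C (envelope C T D) Y r"
        by (rule central_localization.envelope_local[OF loc[OF p(1)] assms(4) Yp])
      then show False using p(2) by blast
    qed
    then show "Y \<in> envelope C T D"
      using scalar_factors_oneD[OF env(4,1) assms(5)] by blast
  qed
  then show ?thesis by (simp add: on_obj)
qed

end
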